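(* Let $A\in\mathbb{Q}^{m\times n}$ and fix an iteration index $i>0$ and a sequence of $i$ column exchanges taking an initial basis matrix $B^{(0)}$ through $B^{(1)},\dots,B^{(i)}$ (all nonsingular $m\times m$ submatrices of $A$, up to column order). Suppose the factors $L$, $G^{(i)}$, $U^{(i)}$ of $B^{(i)}$ are computed in floating-point arithmetic with unit roundoff $\epsilon$ by the Bartels–Golub procedure, and let $\hat x$ be the floating-point solution of $B^{(i)}x=b$, $b\in\mathbb{Q}^m$, obtained by solving successively with $L$ (forward substitution), with $G^{(i)}$ (successive application of the stored elementary factors) and with $U^{(i)}$ (backward substitution). Then the a priori backward error $\mathcal{E}^{(i)}$, i.e. the matrix with $(B^{(i)}+\mathcal{E}^{(i)})\hat x=b$ given by $$\mathcal{E}^{(i)}=\Delta B^{(i)}+LG^{(i)}\Delta U^{(i)}+L\,\Delta G^{(i)}U^{(i)}+\Delta L\,G^{(i)}U^{(i)}+L\,\Delta G^{(i)}\Delta U^{(i)}+\Delta L\,G^{(i)}\Delta U^{(i)}+\Delta L\,\Delta G^{(i)}U^{(i)}+\Delta L\,\Delta G^{(i)}\Delta U^{(i)},$$ satisfies $$\|\mathcal{E}^{(i)}\|_1=O(\epsilon)\quad\text{as }\epsilon\to0 .$$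
   Context: Norm: $\|M\|_1=\max_j\sum_i|M_{i,j}|$. Asymptotics: $f(\epsilon)=O(g(\epsilon))$ means there are $K,\epsilon_0>0$ with $|f(\epsilon)|\le K|g(\epsilon)|$ for all $0<\epsilon<\epsilon_0$; $K,\epsilon_0$ may depend on the fixed data and on the iteration index $i$ (and pivot sequence) but not on $\epsilon$. Floating-point model (unit roundoff $\epsilon$, no overflow/underflow): for floating-point numbers $x,y$ and $\odot\in\{+,-,\times,/\}$, the computed result is $\mathrm{fl}_\epsilon(x\odot y)=(x\odot y)(1+\eta)^{p}$ for some $|\eta|\le\epsilon$, where $p=1$ or $p=-1$ may be chosen according to convenience. The entries of $A$ and $b$ are regarded as exactly stored floating-point numbers (rounding of input data is not part of this statement). Bartels–Golub procedure (an overall row permutation $\Pi$ is ignored for notational simplicity). Initially $B^{(0)}$ is factorized in floating-point arithmetic by Gaussian elimination with partial pivoting into computed $L$ (unit lower triangular) and $U^{(0)}$ (upper triangular). At update $k\ge1$, column $l_k$ of $B^{(k-1)}$ is deleted, the later columns are shifted left, and a column $A_{:,e_k}$ is appended as the last column, giving $B^{(k)}$. Correspondingly $H^{(k)}$ is obtained from $U^{(k-1)}$ by deleting column $l_k$, shifting left, and appending the computed vector $\mathrm{fl}_\epsilon((G^{(k-1)})^{-1}L^{-1}A_{:,e_k})$; it is upper Hessenberg. For $j=l_k,\dots,m-1$: rows $j,j+1$ are swapped if needed (permutation $\Pi^{(k)}_j$, equal to the identity or to the swap) so that the entry of largest absolute value in column $j$ among these two rows is the pivot, and $g^{(k)}_j$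 times row $j$ is subtracted from row $j+1$, with $|g_j^{(k)}|\le1$ the computed quotient of the two entries; this is multiplication by $\Gamma^{(k)}_j=I-g^{(k)}_je_{j+1}e_j^T$ ($e_j$ the standard basis vectors). The computed result is the upper triangular $U^{(k)}$. Set $C^{(k)}=\Pi^{(k)}_{l_k}(\Gamma^{(k)}_{l_k})^{-1}\cdots\Pi^{(k)}_{m-1}(\Gamma^{(k)}_{m-1})^{-1}$ and $G^{(k)}=C^{(1)}\cdots C^{(k)}$, $G^{(0)}=I$ ($L$ is kept fixed). Error matrices: $\Delta B^{(i)}:=LG^{(i)}U^{(i)}-B^{(i)}$ (exact product of the stored computed factors); $\Delta L,\Delta G^{(i)},\Delta U^{(i)}$ are the backward errors of the three computed solves, i.e. the computed vectors satisfy exactly $(L+\Delta L)y=b$, $(G^{(i)}+\Delta G^{(i)})z=y$, $(U^{(i)}+\Delta U^{(i)})\hat x=z$. Here $\Delta L$ and $\Delta U^{(i)}$ are the standard substitution backward errors, and $\Delta G^{(i)}$ is the one obtained by perturbing each elementary factor $(\Gamma_j^{(k)})^{-1}$ by the rounding errors of the one multiplication and one subtraction performed when applying $\Gamma_j^{(k)}$. *)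

theory Defs
  imports Complex_Main "Jordan_Normal_Form.Gauss_Jordan_Elimination"
begin

text \<open>All matrix and vector indices are 0-based; updates are numbered \<open>1, \<dots>, i\<close>.\<close>

definition norm1_mat :: "real mat \<Rightarrow> real" where
  "norm1_mat M = Max ((\<lambda>c. \<Sum>r<dim_row M. \<bar>M $$ (r, c)\<bar>) ` {..<dim_col M})"


subsection \<open>Floating-point model\<close>

text \<open>\<open>fl \<epsilon> v c\<close>: \<open>c\<close> is an admissible computed value of an operation with exact result \<open>v\<close>.
  The representation \<open>c = v (1 + \<eta>)\<^sup>p\<close> is available for \<open>p = 1\<close> and for \<open>p = -1\<close>, with errors
  \<open>\<eta>\<close> that may differ; \<open>fl_err\<close> names the error belonging to a chosen \<open>p\<close>. Computations are
  relations, so that every arithmetic obeying the model is covered.\<close>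

definition fl_err :: "real \<Rightarrow> int \<Rightarrow> real \<Rightarrow> real \<Rightarrow> real \<Rightarrow> bool" where
  "fl_err \<epsilon> p v \<eta> c \<longleftrightarrow> \<bar>\<eta>\<bar> \<le> \<epsilon> \<and> c = v * (1 + \<eta>) powi p"

definition fl :: "real \<Rightarrow> real \<Rightarrow> real \<Rightarrow> bool" where
  "fl \<epsilon> v c \<longleftrightarrow> (\<forall>p\<in>{1, -1}. \<exists>\<eta>. fl_err \<epsilon> p v \<eta> c)"


subsection \<open>Gaussian elimination with partial pivoting\<close>

text \<open>One in-place step: row \<open>p\<close> is the pivot row of column \<open>k\<close>; the multipliers are stored below
  the diagonal and take part in the interchanges.\<close>

definition gepp_step :: "real \<Rightarrow> nat \<Rightarrow> nat \<Rightarrow> nat \<Rightarrow> real mat \<Rightarrow> real mat \<Rightarrow> bool" where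
  "gepp_step \<epsilon> m k p W W' \<longleftrightarrow>
     k \<le> p \<and> p < m \<and> (\<forall>r\<in>{k..<m}. \<bar>W $$ (r, k)\<bar> \<le> \<bar>W $$ (p, k)\<bar>) \<and>
     W' \<in> carrier_mat m m \<and>
     (let V = swaprows_mat m k p * W in
      \<forall>r<m. \<forall>c<m.
        if r \<le> k \<or> c < k then W' $$ (r, c) = V $$ (r, c)
        else if c = k then fl \<epsilon> (V $$ (r, k) / V $$ (k, k)) (W' $$ (r, k))
        else \<exists>t. fl \<epsilon> (W' $$ (r, k) * V $$ (k, c)) t \<and> fl \<epsilon> (V $$ (r, c) - t) (W' $$ (r, c)))"

fun interchanges :: "nat \<Rightarrow> (nat \<Rightarrow> nat) \<Rightarrow> nat \<Rightarrow> real mat" where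
  "interchanges m piv 0 = 1\<^sub>m m"
| "interchanges m piv (Suc k) = swaprows_mat m k (piv k) * interchanges m piv k"

text \<open>Computed factors \<open>L U \<approx> P B\<close>, where \<open>P\<close> is the overall row permutation.\<close>

definition gepp :: "real \<Rightarrow> nat \<Rightarrow> real mat \<Rightarrow> real mat \<Rightarrow> real mat \<Rightarrow> real mat \<Rightarrow> bool" where
  "gepp \<epsilon> m B P L U \<longleftrightarrow>
     (\<exists>W piv. W 0 = B \<and> (\<forall>k<m - 1. gepp_step \<epsilon> m k (piv k) (W k) (W (Suc k))) \<and>
        P = interchanges m piv (m - 1) \<and>
        L = mat m m (\<lambda>(r, c). if c < r then W (m - 1) $$ (r, c) else if c = r then 1 else 0) \<and>
        U = mat m m (\<lambda>(r, c). if r \<le> c then W (m - 1) $$ (r, c) else 0))"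


subsection \<open>Triangular solves and their backward errors\<close>

text \<open>Row \<open>r\<close> starts with \<open>S r 0 = b\<^sub>r\<close> and subtracts the computed products \<open>T r c\<close> of
  \<open>L\<^sub>r\<^sub>c\<close> and \<open>y\<^sub>c\<close> for \<open>c = 0, \<dots>, r - 1\<close>. Using \<open>p = 1\<close> for the products (errors \<open>\<mu>\<close>) and
  \<open>p = -1\<close> for the subtractions (errors \<open>\<sigma>\<close>) gives \<open>S r c = T r c + (1 + \<sigma> r c) S r (c + 1)\<close>;
  unrolling this yields the entries of \<open>\<Delta>L\<close>. The diagonal of \<open>L\<close> is 1, so nothing is divided.\<close>

definition forward_subst ::
  "real \<Rightarrow> nat \<Rightarrow> real mat \<Rightarrow> real vec \<Rightarrow> real vec \<Rightarrow> real mat \<Rightarrow> bool" where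
  "forward_subst \<epsilon> m L b y \<Delta>L \<longleftrightarrow> y \<in> carrier_vec m \<and>
     (\<exists>S T \<mu> \<sigma>.
        (\<forall>r<m. S r 0 = b $ r \<and>
           (\<forall>c<r. fl \<epsilon> (L $$ (r, c) * y $ c) (T r c) \<and>
                  fl_err \<epsilon> 1 (L $$ (r, c) * y $ c) (\<mu> r c) (T r c) \<and>
                  fl \<epsilon> (S r c - T r c) (S r (Suc c)) \<and>
                  fl_err \<epsilon> (-1) (S r c - T r c) (\<sigma> r c) (S r (Suc c))) \<and>
           y $ r = S r r) \<and>
        \<Delta>L = mat m m (\<lambda>(r, c).
          if c < r then L $$ (r, c) * ((1 + \<mu> r c) * (\<Prod>q<c. 1 + \<sigma> r q) - 1)
          else if c = r then L $$ (r, r) * ((\<Prod>q<r. 1 + \<sigma> r q) - 1)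
          else 0))"

text \<open>Likewise for \<open>U x = z\<close>, with columns \<open>c = r + 1, \<dots>, m - 1\<close> in row \<open>r\<close> and a final division
  with \<open>p = -1\<close> (error \<open>\<delta>\<close>).\<close>

definition backward_subst ::
  "real \<Rightarrow> nat \<Rightarrow> real mat \<Rightarrow> real vec \<Rightarrow> real vec \<Rightarrow> real mat \<Rightarrow> bool" where
  "backward_subst \<epsilon> m U z x \<Delta>U \<longleftrightarrow> x \<in> carrier_vec m \<and>
     (\<exists>S T \<mu> \<sigma> \<delta>.
        (\<forall>r<m. S r (Suc r) = z $ r \<and>
           (\<forall>c\<in>{Suc r..<m}. fl \<epsilon> (U $$ (r, c) * x $ c) (T r c) \<and>
                  fl_err \<epsilon> 1 (U $$ (r, c) * x $ c) (\<mu> r c) (T r c) \<and>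
                  fl \<epsilon> (S r c - T r c) (S r (Suc c)) \<and>
                  fl_err \<epsilon> (-1) (S r c - T r c) (\<sigma> r c) (S r (Suc c))) \<and>
           fl \<epsilon> (S r m / U $$ (r, r)) (x $ r) \<and>
           fl_err \<epsilon> (-1) (S r m / U $$ (r, r)) (\<delta> r) (x $ r)) \<and>
        \<Delta>U = mat m m (\<lambda>(r, c).
          if r < c then U $$ (r, c) * ((1 + \<mu> r c) * (\<Prod>q\<in>{Suc r..<c}. 1 + \<sigma> r q) - 1)
          else if c = r then U $$ (r, r) * ((1 + \<delta> r) * (\<Prod>q\<in>{Suc r..<m}. 1 + \<sigma> r q) - 1)
          else 0))"


subsection \<open>Elementary factors of the updates\<close>

definition swap_mat :: "nat \<Rightarrow> nat \<Rightarrow> bool \<Rightarrow> real mat" where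
  "swap_mat m j sw = (if sw then swaprows_mat m j (Suc j) else 1\<^sub>m m)"

text \<open>\<open>\<Gamma> = I - g e\<^sub>j\<^sub>+\<^sub>1 e\<^sub>j\<^sup>T\<close>, and its inverse.\<close>

definition Gamma_mat :: "nat \<Rightarrow> nat \<Rightarrow> real \<Rightarrow> real mat" where
  "Gamma_mat m j g = addrow_mat m (- g) (Suc j) j"

definition Gamma_inv_mat :: "nat \<Rightarrow> nat \<Rightarrow> real \<Rightarrow> real mat" where
  "Gamma_inv_mat m j g = addrow_mat m g (Suc j) j"

lemma Gamma_inv_mat:
  assumes "Suc j < m"
  shows "inverts_mat (Gamma_mat m j g) (Gamma_inv_mat m j g)"
    and "inverts_mat (Gamma_inv_mat m j g) (Gamma_mat m j g)"
  using assms addrow_mat_inv[of "Suc j" m j g] addrow_mat_inv[of "Suc j" m j "- g"]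
  by (auto simp: inverts_mat_def Gamma_mat_def Gamma_inv_mat_def)

text \<open>Families \<open>sw k j\<close>, \<open>g k j\<close> hold the interchanges and multipliers of update \<open>k\<close>, which acts
  on the row pairs \<open>(j, j + 1)\<close> with \<open>j = l k, \<dots>, m - 2\<close>.\<close>

definition C_mat :: "nat \<Rightarrow> (nat \<Rightarrow> nat) \<Rightarrow> (nat \<Rightarrow> nat \<Rightarrow> bool) \<Rightarrow> (nat \<Rightarrow> nat \<Rightarrow> real) \<Rightarrow> nat \<Rightarrow> real mat"
  where
  "C_mat m l sw g k =
     foldr (*) (map (\<lambda>j. swap_mat m j (sw k j) * Gamma_inv_mat m j (g k j)) [l k..<m - 1]) (1\<^sub>m m)"

fun G_mat :: "nat \<Rightarrow> (nat \<Rightarrow> nat) \<Rightarrow> (nat \<Rightarrow> nat \<Rightarrow> bool) \<Rightarrow> (nat \<Rightarrow> nat \<Rightarrow> real) \<Rightarrow> nat \<Rightarrow> real mat"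
  where
  "G_mat m l sw g 0 = 1\<^sub>m m"
| "G_mat m l sw g (Suc k) = G_mat m l sw g k * C_mat m l sw g (Suc k)"

definition factors_of_G ::
  "nat \<Rightarrow> (nat \<Rightarrow> nat) \<Rightarrow> (nat \<Rightarrow> nat \<Rightarrow> bool) \<Rightarrow> (nat \<Rightarrow> nat \<Rightarrow> real) \<Rightarrow> nat \<Rightarrow> (nat \<times> bool \<times> real) list"
  where
  "factors_of_G m l sw g k =
     concat (map (\<lambda>k'. map (\<lambda>j. (j, sw k' j, g k' j)) [l k'..<m - 1]) [1..<Suc k])"

text \<open>Successive application of the stored factors to \<open>v\<close>, with result \<open>z\<close>. From
  \<open>t = g v\<^sub>j (1 + \<mu>)\<close> and \<open>w = (v\<^sub>j\<^sub>+\<^sub>1 - t) / (1 + \<sigma>)\<close> one gets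
  \<open>v\<^sub>j\<^sub>+\<^sub>1 = g (1 + \<mu>) v\<^sub>j + (1 + \<sigma>) w\<close>, i.e. the inverse elementary factor is replaced by
  \<open>perturbed_Gamma_inv\<close>. The last argument is the product of all factors so perturbed.\<close>

definition perturbed_Gamma_inv :: "nat \<Rightarrow> nat \<Rightarrow> real \<Rightarrow> real \<Rightarrow> real \<Rightarrow> real mat" where
  "perturbed_Gamma_inv m j g \<mu> \<sigma> = mat m m (\<lambda>(r, c).
     if r = Suc j \<and> c = j then g * (1 + \<mu>)
     else if r = Suc j \<and> c = Suc j then 1 + \<sigma>
     else if r = c then 1 else 0)"

fun apply_factors ::
  "real \<Rightarrow> nat \<Rightarrow> (nat \<times> bool \<times> real) list \<Rightarrow> real vec \<Rightarrow> real vec \<Rightarrow> real mat \<Rightarrow> bool" where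
  "apply_factors \<epsilon> m [] v z M \<longleftrightarrow> z = v \<and> M = 1\<^sub>m m"
| "apply_factors \<epsilon> m ((j, sw, g) # fs) v z M \<longleftrightarrow>
     (let u = swap_mat m j sw *\<^sub>v v in
      \<exists>t w \<mu> \<sigma> M'.
        fl \<epsilon> (g * u $ j) t \<and> fl_err \<epsilon> 1 (g * u $ j) \<mu> t \<and>
        fl \<epsilon> (u $ Suc j - t) w \<and> fl_err \<epsilon> (-1) (u $ Suc j - t) \<sigma> w \<and>
        apply_factors \<epsilon> m fs (vec m (\<lambda>r. if r = Suc j then w else u $ r)) z M' \<and>
        M = swap_mat m j sw * perturbed_Gamma_inv m j g \<mu> \<sigma> * M')"

definition G_solve ::
  "real \<Rightarrow> nat \<Rightarrow> (nat \<Rightarrow> nat) \<Rightarrow> (nat \<Rightarrow> nat \<Rightarrow> bool) \<Rightarrow> (nat \<Rightarrow> nat \<Rightarrow> real) \<Rightarrow> nat \<Rightarrow>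
   real vec \<Rightarrow> real vec \<Rightarrow> real mat \<Rightarrow> bool" where
  "G_solve \<epsilon> m l sw g k y z \<Delta>G \<longleftrightarrow>
     (\<exists>M. apply_factors \<epsilon> m (factors_of_G m l sw g k) y z M \<and> \<Delta>G = M - G_mat m l sw g k)"


subsection \<open>Bartels--Golub updates\<close>

text \<open>Delete column \<open>l\<close>, shift the later columns left, append \<open>a\<close>.\<close>

definition exchange_col :: "nat \<Rightarrow> nat \<Rightarrow> real mat \<Rightarrow> real vec \<Rightarrow> real mat" where
  "exchange_col m l M a = mat m m (\<lambda>(r, c).
     if c = m - 1 then a $ r else if c < l then M $$ (r, c) else M $$ (r, Suc c))"

fun basis_mat ::
  "nat \<Rightarrow> real mat \<Rightarrow> nat list \<Rightarrow> (nat \<Rightarrow> nat) \<Rightarrow> (nat \<Rightarrow> nat) \<Rightarrow> nat \<Rightarrow> real mat" where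
  "basis_mat m A cs l e 0 = mat m m (\<lambda>(r, c). A $$ (r, cs ! c))"
| "basis_mat m A cs l e (Suc k) =
     exchange_col m (l (Suc k)) (basis_mat m A cs l e k) (col A (e (Suc k)))"

text \<open>Elimination of the subdiagonal entry of column \<open>j\<close> of a Hessenberg matrix; the eliminated
  entry is set to zero, and the entries of both rows left of column \<open>j\<close> are already zero.\<close>

definition hessenberg_step ::
  "real \<Rightarrow> nat \<Rightarrow> nat \<Rightarrow> bool \<Rightarrow> real \<Rightarrow> real mat \<Rightarrow> real mat \<Rightarrow> bool" where
  "hessenberg_step \<epsilon> m j sw g R R' \<longleftrightarrow> R' \<in> carrier_mat m m \<and>
     (let V = swap_mat m j sw * R in
      \<bar>V $$ (Suc j, j)\<bar> \<le> \<bar>V $$ (j, j)\<bar> \<and>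
      fl \<epsilon> (V $$ (Suc j, j) / V $$ (j, j)) g \<and> \<bar>g\<bar> \<le> 1 \<and>
      (\<forall>r<m. \<forall>c<m.
         if r = Suc j \<and> c = j then R' $$ (r, c) = 0
         else if r = Suc j \<and> j < c then
           \<exists>t. fl \<epsilon> (g * V $$ (j, c)) t \<and> fl \<epsilon> (V $$ (r, c) - t) (R' $$ (r, c))
         else R' $$ (r, c) = V $$ (r, c)))"

definition bg_update ::
  "real \<Rightarrow> nat \<Rightarrow> nat \<Rightarrow> real vec \<Rightarrow> (nat \<Rightarrow> bool) \<Rightarrow> (nat \<Rightarrow> real) \<Rightarrow> real mat \<Rightarrow> real mat \<Rightarrow> bool" where
  "bg_update \<epsilon> m l a sw g U U' \<longleftrightarrow>
     (\<exists>R. R l = exchange_col m l U a \<and>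
        (\<forall>j\<in>{l..<m - 1}. hessenberg_step \<epsilon> m j (sw j) (g j) (R j) (R (Suc j))) \<and>
        U' = R (m - 1))"

text \<open>\<open>U k\<close> for \<open>k \<le> i\<close>, together with \<open>L\<close>, \<open>sw\<close> and \<open>g\<close>, are factors computed with unit
  roundoff \<open>\<epsilon>\<close>. The row permutation \<open>P\<close> of the initial factorization applies to all columns
  of \<open>A\<close>.\<close>

definition bartels_golub ::
  "real \<Rightarrow> nat \<Rightarrow> real mat \<Rightarrow> nat list \<Rightarrow> (nat \<Rightarrow> nat) \<Rightarrow> (nat \<Rightarrow> nat) \<Rightarrow> nat \<Rightarrow>
   real mat \<Rightarrow> real mat \<Rightarrow> (nat \<Rightarrow> nat \<Rightarrow> bool) \<Rightarrow> (nat \<Rightarrow> nat \<Rightarrow> real) \<Rightarrow> (nat \<Rightarrow> real mat) \<Rightarrow> bool" where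
  "bartels_golub \<epsilon> m A cs l e i P L sw g U \<longleftrightarrow>
     gepp \<epsilon> m (basis_mat m A cs l e 0) P L (U 0) \<and>
     (\<forall>k<i. \<exists>y \<Delta>L a \<Delta>G.
        forward_subst \<epsilon> m L (P *\<^sub>v col A (e (Suc k))) y \<Delta>L \<and>
        G_solve \<epsilon> m l sw g k y a \<Delta>G \<and>
        bg_update \<epsilon> m (l (Suc k)) a (sw (Suc k)) (g (Suc k)) (U k) (U (Suc k)))"

definition backward_error ::
  "real mat \<Rightarrow> real mat \<Rightarrow> real mat \<Rightarrow> real mat \<Rightarrow> real mat \<Rightarrow> real mat \<Rightarrow> real mat \<Rightarrow> real mat" where
  "backward_error B L G U \<Delta>L \<Delta>G \<Delta>U =
     (let \<Delta>B = L * G * U - B in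
      \<Delta>B + L * G * \<Delta>U + L * \<Delta>G * U + \<Delta>L * G * U
      + L * \<Delta>G * \<Delta>U + \<Delta>L * G * \<Delta>U + \<Delta>L * \<Delta>G * U + \<Delta>L * \<Delta>G * \<Delta>U)"


subsection \<open>The three solves satisfy their perturbed systems exactly\<close>

lemma fl_err_1: "fl_err \<epsilon> 1 v \<eta> c \<Longrightarrow> c = v * (1 + \<eta>)"
  by (simp add: fl_err_def)

lemma fl_err_minus_1:
  assumes "fl_err \<epsilon> (-1) v \<eta> c" "\<epsilon> < 1"
  shows "v = (1 + \<eta>) * c"
proof -
  have "1 + \<eta> \<noteq> 0" using assms by (auto simp: fl_err_def)
  then show ?thesis using assms by (simp add: fl_err_def power_int_minus field_simps)
qed

lemma forward_subst_backward_error: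
  assumes fs: "forward_subst \<epsilon> m L b y \<Delta>L" and "\<epsilon> < 1"
    and L: "L \<in> carrier_mat m m" "\<And>r. r < m \<Longrightarrow> L $$ (r, r) = 1"
      "\<And>r c. r < c \<Longrightarrow> c < m \<Longrightarrow> L $$ (r, c) = 0"
    and b: "b \<in> carrier_vec m"
  shows "(L + \<Delta>L) *\<^sub>v y = b"
proof -
  from fs obtain S T \<mu> \<sigma> where y: "y \<in> carrier_vec m" and
    run: "\<And>r. r < m \<Longrightarrow> S r 0 = b $ r" "\<And>r. r < m \<Longrightarrow> y $ r = S r r"
      "\<And>r c. c < r \<Longrightarrow> r < m \<Longrightarrow> fl_err \<epsilon> 1 (L $$ (r, c) * y $ c) (\<mu> r c) (T r c)"
      "\<And>r c. c < r \<Longrightarrow> r < m \<Longrightarrow> fl_err \<epsilon> (-1) (S r c - T r c) (\<sigma> r c) (S r (Suc c))" and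
    D: "\<Delta>L = mat m m (\<lambda>(r, c).
          if c < r then L $$ (r, c) * ((1 + \<mu> r c) * (\<Prod>q<c. 1 + \<sigma> r q) - 1)
          else if c = r then L $$ (r, r) * ((\<Prod>q<r. 1 + \<sigma> r q) - 1)
          else 0)"
    unfolding forward_subst_def by blast
  have T: "T r c = L $$ (r, c) * y $ c * (1 + \<mu> r c)" if "c < r" "r < m" for r c
    using run(3)[OF that] by (rule fl_err_1)
  have S: "S r c = T r c + (1 + \<sigma> r c) * S r (Suc c)" if "c < r" "r < m" for r c
    using fl_err_minus_1[OF run(4)[OF that] \<open>\<epsilon> < 1\<close>] by simp
  have unroll: "b $ r = (\<Sum>c<k. T r c * (\<Prod>q<c. 1 + \<sigma> r q)) + (\<Prod>q<k. 1 + \<sigma> r q) * S r k"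
    if "k \<le> r" "r < m" for r k
    using that(1)
  proof (induction k)
    case 0 then show ?case using run(1) that by simp
  next
    case (Suc k)
    then show ?case using S[of k r] that by (simp add: algebra_simps)
  qed
  show ?thesis
  proof (rule eq_vecI)
    fix r assume "r < dim_vec b"
    then have r: "r < m" using b by simp
    let ?f = "\<lambda>c. (L + \<Delta>L) $$ (r, c) * y $ c"
    have "((L + \<Delta>L) *\<^sub>v y) $ r = (\<Sum>c<m. ?f c)"
      using r y L D by (simp add: scalar_prod_def row_def lessThan_atLeast0)
    also have "\<dots> = (\<Sum>c\<in>{..r}. ?f c)"
      by (rule sum.mono_neutral_right) (use r L D in auto)
    also have "\<dots> = (\<Sum>c<r. ?f c) + ?f r"
      by (simp flip: lessThan_Suc_atMost)
    also have "\<dots> = (\<Sum>c<r. T r c * (\<Prod>q<c. 1 + \<sigma> r q)) + (\<Prod>q<r. 1 + \<sigma> r q) * S r r"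
      using r L D T run(2)[OF r] by (intro arg_cong2[of _ _ _ _ "(+)"] sum.cong) (auto simp: algebra_simps)
    also have "\<dots> = b $ r" using unroll[of r r] r by simp
    finally show "((L + \<Delta>L) *\<^sub>v y) $ r = b $ r" .
  qed (use b D L in auto)
qed

lemma backward_subst_backward_error:
  assumes bs: "backward_subst \<epsilon> m U z x \<Delta>U" and "\<epsilon> < 1"
    and U: "U \<in> carrier_mat m m" "\<And>r. r < m \<Longrightarrow> U $$ (r, r) \<noteq> 0"
      "\<And>r c. c < r \<Longrightarrow> r < m \<Longrightarrow> U $$ (r, c) = 0"
    and z: "z \<in> carrier_vec m"
  shows "(U + \<Delta>U) *\<^sub>v x = z"
proof -
  from bs obtain S T \<mu> \<sigma> \<delta> where x: "x \<in> carrier_vec m" and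
    run: "\<And>r. r < m \<Longrightarrow> S r (Suc r) = z $ r"
      "\<And>r. r < m \<Longrightarrow> fl_err \<epsilon> (-1) (S r m / U $$ (r, r)) (\<delta> r) (x $ r)"
      "\<And>r c. r < m \<Longrightarrow> c \<in> {Suc r..<m} \<Longrightarrow> fl_err \<epsilon> 1 (U $$ (r, c) * x $ c) (\<mu> r c) (T r c)"
      "\<And>r c. r < m \<Longrightarrow> c \<in> {Suc r..<m} \<Longrightarrow> fl_err \<epsilon> (-1) (S r c - T r c) (\<sigma> r c) (S r (Suc c))" and
    D: "\<Delta>U = mat m m (\<lambda>(r, c).
          if r < c then U $$ (r, c) * ((1 + \<mu> r c) * (\<Prod>q\<in>{Suc r..<c}. 1 + \<sigma> r q) - 1)
          else if c = r then U $$ (r, r) * ((1 + \<delta> r) * (\<Prod>q\<in>{Suc r..<m}. 1 + \<sigma> r q) - 1)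
          else 0)"
    unfolding backward_subst_def by blast
  have T: "T r c = U $$ (r, c) * x $ c * (1 + \<mu> r c)" if "r < c" "c < m" for r c
    using run(3)[of r c] that by (auto intro: fl_err_1)
  have S: "S r c = T r c + (1 + \<sigma> r c) * S r (Suc c)" if "r < c" "c < m" for r c
    using fl_err_minus_1[OF run(4)[of r c] \<open>\<epsilon> < 1\<close>] that by simp
  have diag: "S r m = U $$ (r, r) * (1 + \<delta> r) * x $ r" if "r < m" for r
    using fl_err_minus_1[OF run(2)[OF that] \<open>\<epsilon> < 1\<close>] U(2)[OF that] by (simp add: field_simps)
  have unroll: "z $ r = (\<Sum>c\<in>{Suc r..<k}. T r c * (\<Prod>q\<in>{Suc r..<c}. 1 + \<sigma> r q))
      + (\<Prod>q\<in>{Suc r..<k}. 1 + \<sigma> r q) * S r k" if "Suc r \<le> k" "k \<le> m" for r k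
    using that
  proof (induction k rule: dec_induct)
    case base then show ?case using run(1)[of r] by simp
  next
    case (step k)
    then show ?case using S[of r k] by (simp add: algebra_simps)
  qed
  show ?thesis
  proof (rule eq_vecI)
    fix r assume "r < dim_vec z"
    then have r: "r < m" using z by simp
    let ?f = "\<lambda>c. (U + \<Delta>U) $$ (r, c) * x $ c"
    have "((U + \<Delta>U) *\<^sub>v x) $ r = (\<Sum>c\<in>{0..<m}. ?f c)"
      using r x U D by (simp add: scalar_prod_def row_def)
    also have "\<dots> = (\<Sum>c\<in>{r..<m}. ?f c)"
      by (rule sum.mono_neutral_right) (use r U D in auto)
    also have "\<dots> = ?f r + (\<Sum>c\<in>{Suc r..<m}. ?f c)"
      using r by (rule sum.atLeast_Suc_lessThan)
    also have "\<dots> = (\<Prod>q\<in>{Suc r..<m}. 1 + \<sigma> r q) * S r m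
        + (\<Sum>c\<in>{Suc r..<m}. T r c * (\<Prod>q\<in>{Suc r..<c}. 1 + \<sigma> r q))"
      using r U D T diag[OF r] by (intro arg_cong2[of _ _ _ _ "(+)"] sum.cong) (auto simp: algebra_simps)
    also have "\<dots> = z $ r" using unroll[of r m] r by simp
    finally show "((U + \<Delta>U) *\<^sub>v x) $ r = z $ r" .
  qed (use z D U in auto)
qed

lemma swap_mat_carrier: "swap_mat m j s \<in> carrier_mat m m"
  by (simp add: swap_mat_def)

lemma swap_mat_involution:
  assumes "Suc j < m"
  shows "swap_mat m j s * swap_mat m j s = 1\<^sub>m m"
  using assms swaprows_mat_inv[of j m "Suc j"] by (auto simp: swap_mat_def)

lemma apply_factors_backward_error:
  assumes "apply_factors \<epsilon> m fs v z M" "\<epsilon> < 1"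
    and "\<And>j s g. (j, s, g) \<in> set fs \<Longrightarrow> Suc j < m" and "v \<in> carrier_vec m"
  shows "M \<in> carrier_mat m m \<and> z \<in> carrier_vec m \<and> M *\<^sub>v z = v"
  using assms
proof (induction fs arbitrary: v M)
  case (Cons f fs)
  obtain j s g where f: "f = (j, s, g)" by (cases f) auto
  have j: "Suc j < m" using Cons.prems(3) f by auto
  define u where "u = swap_mat m j s *\<^sub>v v"
  from Cons.prems(1) obtain t w \<mu> \<sigma> M' where
    t: "fl_err \<epsilon> 1 (g * u $ j) \<mu> t" and w: "fl_err \<epsilon> (-1) (u $ Suc j - t) \<sigma> w" and
    rec: "apply_factors \<epsilon> m fs (vec m (\<lambda>r. if r = Suc j then w else u $ r)) z M'" and
    M: "M = swap_mat m j s * perturbed_Gamma_inv m j g \<mu> \<sigma> * M'"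
    unfolding f apply_factors.simps Let_def u_def[symmetric] by blast
  let ?v = "vec m (\<lambda>r. if r = Suc j then w else u $ r)"
  let ?N = "perturbed_Gamma_inv m j g \<mu> \<sigma>"
  have N: "?N \<in> carrier_mat m m" by (simp add: perturbed_Gamma_inv_def)
  have u: "u \<in> carrier_vec m"
    unfolding u_def using swap_mat_carrier[of m j s] Cons.prems(4) by auto
  have IH: "M' \<in> carrier_mat m m" "z \<in> carrier_vec m" "M' *\<^sub>v z = ?v"
    using Cons.IH[OF rec Cons.prems(2)] Cons.prems(3) by auto
  have uj: "u $ Suc j = g * (1 + \<mu>) * u $ j + (1 + \<sigma>) * w"
    using fl_err_1[OF t] fl_err_minus_1[OF w Cons.prems(2)] by (simp add: algebra_simps)
  have Nv: "?N *\<^sub>v ?v = u"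
  proof (rule eq_vecI)
    fix r assume "r < dim_vec u"
    then have r: "r < m" using u by simp
    have "(?N *\<^sub>v ?v) $ r = (\<Sum>c<m. ?N $$ (r, c) * ?v $ c)"
      using r N by (simp add: scalar_prod_def row_def lessThan_atLeast0)
    also have "\<dots> = u $ r"
    proof (cases "r = Suc j")
      case True
      have "(\<Sum>c<m. ?N $$ (r, c) * ?v $ c) = (\<Sum>c\<in>{j, Suc j}. ?N $$ (r, c) * ?v $ c)"
        by (rule sum.mono_neutral_right) (use r j True in \<open>auto simp: perturbed_Gamma_inv_def\<close>)
      also have "\<dots> = u $ r" using True j uj by (simp add: perturbed_Gamma_inv_def)
      finally show ?thesis .
    next
      case False
      have "(\<Sum>c<m. ?N $$ (r, c) * ?v $ c) = (\<Sum>c\<in>{r}. ?N $$ (r, c) * ?v $ c)"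
        by (rule sum.mono_neutral_right) (use r j False in \<open>auto simp: perturbed_Gamma_inv_def\<close>)
      also have "\<dots> = u $ r" using False r by (simp add: perturbed_Gamma_inv_def)
      finally show ?thesis .
    qed
    finally show "(?N *\<^sub>v ?v) $ r = u $ r" .
  qed (use u N in auto)
  note Sw = swap_mat_carrier[of m j s]
  have SwN: "swap_mat m j s * ?N \<in> carrier_mat m m" using Sw N by (rule mult_carrier_mat)
  have "M *\<^sub>v z = (swap_mat m j s * ?N) *\<^sub>v (M' *\<^sub>v z)"
    unfolding M using SwN IH(1,2) by (rule assoc_mult_mat_vec)
  also have "\<dots> = swap_mat m j s *\<^sub>v (?N *\<^sub>v ?v)"
    unfolding IH(3) using Sw N by (rule assoc_mult_mat_vec) simp
  also have "\<dots> = (swap_mat m j s * swap_mat m j s) *\<^sub>v v"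
    unfolding Nv unfolding u_def using Sw Sw Cons.prems(4) by (rule assoc_mult_mat_vec[symmetric])
  also have "\<dots> = v" using Cons.prems(4) by (simp add: swap_mat_involution[OF j])
  finally have "M *\<^sub>v z = v" .
  moreover have "M \<in> carrier_mat m m" unfolding M using SwN IH(1) by (rule mult_carrier_mat)
  ultimately show ?case using IH(2) by simp
qed auto

lemma G_mat_carrier: "G_mat m l sw g k \<in> carrier_mat m m"
proof (induction k)
  case (Suc k)
  have "foldr (*) (map (\<lambda>j. swap_mat m j (sw k' j) * Gamma_inv_mat m j (g k' j)) js) (1\<^sub>m m)
      \<in> carrier_mat m m" for k' js
    by (induction js) (auto intro!: mult_carrier_mat[of _ m m] simp: swap_mat_carrier Gamma_inv_mat_def)
  then have "C_mat m l sw g (Suc k) \<in> carrier_mat m m" unfolding C_mat_def .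
  with Suc show ?case unfolding G_mat.simps by (rule mult_carrier_mat)
qed simp

lemma G_solve_backward_error:
  assumes "G_solve \<epsilon> m l sw g k y z \<Delta>G" "\<epsilon> < 1" "y \<in> carrier_vec m"
  shows "(G_mat m l sw g k + \<Delta>G) *\<^sub>v z = y"
proof -
  obtain M where M: "apply_factors \<epsilon> m (factors_of_G m l sw g k) y z M"
    and D: "\<Delta>G = M - G_mat m l sw g k"
    using assms(1) unfolding G_solve_def by blast
  have fac: "Suc j < m" if "(j, s, h) \<in> set (factors_of_G m l sw g k)" for j s h
    using that by (auto simp: factors_of_G_def)
  have *: "M \<in> carrier_mat m m" "M *\<^sub>v z = y"
    using apply_factors_backward_error[OF M assms(2) fac assms(3)] by auto
  have "G_mat m l sw g k + \<Delta>G = M"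
    unfolding D using *(1) G_mat_carrier[of m l sw g k] by (intro eq_matI) auto
  then show ?thesis using *(2) by simp
qed

end

theory Submission
  imports Defs "Jordan_Normal_Form.Determinant"
begin

text \<open>
  Every quantity occurring in a run is bounded uniformly in \<open>\<epsilon> < 1\<close>: pivoting keeps the multipliers
  bounded, and each floating-point operation enlarges the entries at most by a constant factor. Hence
  each elimination step, Gaussian or Hessenberg, reproduces its input up to \<open>O(\<epsilon>)\<close> after
  multiplication with the stored elementary factor, also for a vanishing pivot, since then the whole
  pivot column vanishes. The appended column \<open>a\<close> satisfies \<open>(L + \<Delta>L)(G + \<Delta>G) a = P A\<^sub>e\<close> exactly, with
  \<open>\<Delta>L, \<Delta>G = O(\<epsilon>)\<close>. By induction on the updates \<open>L G U - P B = O(\<epsilon>)\<close>, which bounds \<open>E\<close>. Since \<open>B\<close>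
  is nonsingular, the same estimate makes \<open>U\<close> nonsingular for small \<open>\<epsilon>\<close>; this excludes a division by
  zero in the backward substitution, so that \<open>E\<close> is a backward error.
\<close>

section \<open>Entrywise bounds\<close>

text \<open>A run chooses its pivots, interchanges and multipliers anew for every \<epsilon>, and
  nothing is known about their limits. Each constant is therefore fixed before the run and depends
  only on \<open>m\<close>, on the positions \<open>l\<close> and on the sizes of the entries of the
  chosen columns of \<open>A\<close>. The constants are crude powers, since only their independence
  of \<epsilon> matters. Sizes are measured by the largest entry and not by the 1-norm: row swaps
  and column exchanges keep such a bound unchanged, and a product costs a factor \<open>m\<close>.
  The carrier belongs to the bound, so that every estimate also settles the dimensions. A computed
  pivot may be zero or arbitrarily small in comparison with \<epsilon>, so no estimate may contain
  its reciprocal. The residual of an eliminated entry is always measured as multiplier times pivot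
  minus entry, and this stays small for every pivot that dominates the entry. The permutation
  \<open>P\<close> varies with the run as well; its inverse enters only through the bound 1 on the
  entries of a left inverse.\<close>

definition entries_le :: "nat \<Rightarrow> real mat \<Rightarrow> real \<Rightarrow> bool" where
  "entries_le m M X \<longleftrightarrow> M \<in> carrier_mat m m \<and> (\<forall>r<m. \<forall>c<m. \<bar>M $$ (r, c)\<bar> \<le> X)"

definition vec_entries_le :: "nat \<Rightarrow> real vec \<Rightarrow> real \<Rightarrow> bool" where
  "vec_entries_le m v X \<longleftrightarrow> v \<in> carrier_vec m \<and> (\<forall>r<m. \<bar>v $ r\<bar> \<le> X)"

lemma entries_leI:
  "M \<in> carrier_mat m m \<Longrightarrow> (\<And>r c. r < m \<Longrightarrow> c < m \<Longrightarrow> \<bar>M $$ (r, c)\<bar> \<le> X) \<Longrightarrow> entries_le m M X"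
  by (simp add: entries_le_def)

lemma entries_leD: "entries_le m M X \<Longrightarrow> r < m \<Longrightarrow> c < m \<Longrightarrow> \<bar>M $$ (r, c)\<bar> \<le> X"
  by (simp add: entries_le_def)

lemma entries_le_carrier: "entries_le m M X \<Longrightarrow> M \<in> carrier_mat m m"
  by (simp add: entries_le_def)

lemma vec_entries_leI:
  "v \<in> carrier_vec m \<Longrightarrow> (\<And>r. r < m \<Longrightarrow> \<bar>v $ r\<bar> \<le> X) \<Longrightarrow> vec_entries_le m v X"
  by (simp add: vec_entries_le_def)

lemma vec_entries_leD: "vec_entries_le m v X \<Longrightarrow> r < m \<Longrightarrow> \<bar>v $ r\<bar> \<le> X"
  by (simp add: vec_entries_le_def)

lemma vec_entries_le_carrier: "vec_entries_le m v X \<Longrightarrow> v \<in> carrier_vec m"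
  by (simp add: vec_entries_le_def)

lemma entries_le_mono: "entries_le m M X \<Longrightarrow> X \<le> Y \<Longrightarrow> entries_le m M Y"
  by (force simp: entries_le_def)

lemma vec_entries_le_mono: "vec_entries_le m v X \<Longrightarrow> X \<le> Y \<Longrightarrow> vec_entries_le m v Y"
  by (force simp: vec_entries_le_def)

lemma entries_le_nonneg:
  assumes "entries_le m M X" "0 < m"
  shows "0 \<le> X"
  using entries_leD[OF assms(1) assms(2) assms(2)] by linarith

text \<open>Matrix subtraction takes its dimensions from the second operand, so an intermediate
  matrix can be inserted only within a fixed carrier. Every accumulation of step errors below is
  split in this way.\<close>

lemma mat_minus_triangle:
  fixes A B C :: "real mat"
  assumes "A \<in> carrier_mat m n" "B \<in> carrier_mat m n" "C \<in> carrier_mat m n"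
  shows "A - C = (A - B) + (B - C)"
  using assms by (intro eq_matI) auto

lemma index_mult_mat_sum:
  fixes A B :: "real mat"
  assumes "A \<in> carrier_mat m m" "B \<in> carrier_mat m m" "r < m" "c < m"
  shows "(A * B) $$ (r, c) = (\<Sum>q<m. A $$ (r, q) * B $$ (q, c))"
  using assms by (simp add: scalar_prod_def lessThan_atLeast0)

lemma index_mult_mat_vec_sum:
  fixes A :: "real mat"
  assumes "A \<in> carrier_mat m m" "v \<in> carrier_vec m" "r < m"
  shows "(A *\<^sub>v v) $ r = (\<Sum>q<m. A $$ (r, q) * v $ q)"
  using assms by (simp add: scalar_prod_def lessThan_atLeast0)

lemma abs_sum_mult_le:
  fixes f g :: "nat \<Rightarrow> real"
  assumes "\<And>q. q < m \<Longrightarrow> \<bar>f q\<bar> \<le> a" "\<And>q. q < m \<Longrightarrow> \<bar>g q\<bar> \<le> b"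
  shows "\<bar>\<Sum>q<m. f q * g q\<bar> \<le> real m * a * b"
proof -
  have "\<bar>\<Sum>q<m. f q * g q\<bar> \<le> (\<Sum>q<m. \<bar>f q * g q\<bar>)" by (rule sum_abs)
  also have "\<dots> \<le> (\<Sum>q<m. a * b)"
  proof (rule sum_mono)
    fix q assume "q \<in> {..<m}"
    then have "\<bar>f q\<bar> \<le> a" "\<bar>g q\<bar> \<le> b" using assms by auto
    then show "\<bar>f q * g q\<bar> \<le> a * b" unfolding abs_mult by (intro mult_mono) auto
  qed
  finally show ?thesis by simp
qed

lemma entries_le_mult:
  assumes "entries_le m A a" "entries_le m B b"
  shows "entries_le m (A * B) (real m * a * b)"
proof (rule entries_leI)
  show "A * B \<in> carrier_mat m m" using assms by (auto simp: entries_le_def)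
  fix r c assume "r < m" "c < m"
  then show "\<bar>(A * B) $$ (r, c)\<bar> \<le> real m * a * b"
    using assms by (subst index_mult_mat_sum[of _ m])
      (auto intro!: abs_sum_mult_le simp: entries_le_def)
qed

lemma vec_entries_le_mult:
  assumes "entries_le m A a" "vec_entries_le m v b"
  shows "vec_entries_le m (A *\<^sub>v v) (real m * a * b)"
proof (rule vec_entries_leI)
  show "A *\<^sub>v v \<in> carrier_vec m" using assms by (auto simp: entries_le_def vec_entries_le_def)
  fix r assume "r < m"
  then show "\<bar>(A *\<^sub>v v) $ r\<bar> \<le> real m * a * b"
    using assms by (subst index_mult_mat_vec_sum[of _ m])
      (auto intro!: abs_sum_mult_le simp: entries_le_def vec_entries_le_def)
qed

lemma entries_le_add:
  assumes "entries_le m A a" "entries_le m B b"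
  shows "entries_le m (A + B) (a + b)"
proof (rule entries_leI)
  fix r c assume "r < m" "c < m"
  then show "\<bar>(A + B) $$ (r, c)\<bar> \<le> a + b"
    using abs_triangle_ineq[of "A $$ (r, c)" "B $$ (r, c)"] assms
      entries_leD[of m A a r c] entries_leD[of m B b r c] entries_le_carrier[of m B b] by simp
qed (use assms in \<open>auto simp: entries_le_def\<close>)

lemma vec_entries_le_add:
  assumes "vec_entries_le m A a" "vec_entries_le m B b"
  shows "vec_entries_le m (A + B) (a + b)"
proof (rule vec_entries_leI)
  fix r assume "r < m"
  then show "\<bar>(A + B) $ r\<bar> \<le> a + b"
    using abs_triangle_ineq[of "A $ r" "B $ r"] assms
      vec_entries_leD[of m A a r] vec_entries_leD[of m B b r] vec_entries_le_carrier[of m B b] by simp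
qed (use assms in \<open>auto simp: vec_entries_le_def\<close>)

lemma vec_entries_le_minus_commute:
  assumes "vec_entries_le m (v - w) X" "v \<in> carrier_vec m" "w \<in> carrier_vec m"
  shows "vec_entries_le m (w - v) X"
  using assms by (auto simp: vec_entries_le_def abs_minus_commute)

lemma entries_le_one: "entries_le m (1\<^sub>m m) 1"
  by (auto simp: entries_le_def)

lemma entries_le_exists:
  assumes "M \<in> carrier_mat m m"
  shows "\<exists>X\<ge>1. entries_le m M X"
proof (intro exI conjI)
  let ?X = "1 + (\<Sum>r<m. \<Sum>c<m. \<bar>M $$ (r, c)\<bar>)"
  show "1 \<le> ?X" by (simp add: sum_nonneg)
  show "entries_le m M ?X"
  proof (rule entries_leI[OF assms])
    fix r c assume "r < m" "c < m"
    then have "\<bar>M $$ (r, c)\<bar> \<le> (\<Sum>c<m. \<bar>M $$ (r, c)\<bar>)"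
      by (intro member_le_sum[of c "{..<m}" "\<lambda>c. \<bar>M $$ (r, c)\<bar>"]) auto
    also have "\<dots> \<le> (\<Sum>r<m. \<Sum>c<m. \<bar>M $$ (r, c)\<bar>)"
      using \<open>r < m\<close> by (intro member_le_sum[of r "{..<m}" "\<lambda>r. \<Sum>c<m. \<bar>M $$ (r, c)\<bar>"])
        (auto simp: sum_nonneg)
    finally show "\<bar>M $$ (r, c)\<bar> \<le> ?X" by simp
  qed
qed

lemma vec_entries_le_exists:
  assumes "v \<in> carrier_vec m"
  shows "\<exists>X\<ge>1. vec_entries_le m v X"
proof (intro exI conjI)
  let ?X = "1 + (\<Sum>r<m. \<bar>v $ r\<bar>)"
  show "1 \<le> ?X" by (simp add: sum_nonneg)
  show "vec_entries_le m v ?X"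
  proof (rule vec_entries_leI[OF assms])
    fix r assume "r < m"
    then have "\<bar>v $ r\<bar> \<le> (\<Sum>r<m. \<bar>v $ r\<bar>)"
      by (intro member_le_sum[of r "{..<m}" "\<lambda>r. \<bar>v $ r\<bar>"]) auto
    then show "\<bar>v $ r\<bar> \<le> ?X" by simp
  qed
qed

lemma norm1_mat_le:
  assumes "entries_le m M X" "0 < m"
  shows "\<bar>norm1_mat M\<bar> \<le> real m * X"
proof -
  have M: "dim_row M = m" "dim_col M = m" using assms by (auto simp: entries_le_def)
  let ?f = "\<lambda>c. \<Sum>r<m. \<bar>M $$ (r, c)\<bar>"
  have le: "?f c \<le> real m * X" if "c < m" for c
    using sum_bounded_above[of "{..<m}" "\<lambda>r. \<bar>M $$ (r, c)\<bar>" X] entries_leD[OF assms(1)] that by simp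
  have "Max (?f ` {..<m}) \<in> ?f ` {..<m}" using assms(2) by (intro Max_in) auto
  then obtain c where "c < m" "Max (?f ` {..<m}) = ?f c" by auto
  then show ?thesis using le[of c] by (simp add: norm1_mat_def M sum_nonneg)
qed


section \<open>Rounding errors\<close>

lemma fl_error_le:
  assumes "fl \<epsilon> v c"
  shows "\<bar>c - v\<bar> \<le> \<epsilon> * \<bar>v\<bar>"
proof -
  obtain \<eta> where \<eta>: "fl_err \<epsilon> 1 v \<eta> c" using assms by (auto simp: fl_def)
  then have "c - v = \<eta> * v" using fl_err_1[OF \<eta>] by (simp add: algebra_simps)
  then show ?thesis using \<eta> by (simp add: fl_err_def abs_mult mult_right_mono)
qed

lemma fl_abs_le:
  assumes "fl \<epsilon> v c" "\<epsilon> \<le> 1"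
  shows "\<bar>c\<bar> \<le> 2 * \<bar>v\<bar>"
proof -
  have "\<epsilon> * \<bar>v\<bar> \<le> \<bar>v\<bar>" using mult_right_mono[OF assms(2), of "\<bar>v\<bar>"] by simp
  then show ?thesis using fl_error_le[OF assms(1)] by linarith
qed

text \<open>This is the residual left behind when an eliminated entry is replaced by zero. For
  \<open>d = 0\<close> the hypothesis on \<open>x\<close> forces \<open>x = 0\<close>, and both
  sides vanish whatever \<open>q\<close> is; this is how zero pivots are covered.\<close>

lemma fl_quotient_times_divisor:
  assumes "fl \<epsilon> (x / d) q" "\<bar>x\<bar> \<le> \<bar>d\<bar>"
  shows "\<bar>q * d - x\<bar> \<le> \<epsilon> * \<bar>x\<bar>"
proof (cases "d = 0")
  case False
  have "\<bar>q * d - x\<bar> = \<bar>q - x / d\<bar> * \<bar>d\<bar>" using False by (simp flip: abs_mult add: left_diff_distrib)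
  also have "\<dots> \<le> \<epsilon> * \<bar>x / d\<bar> * \<bar>d\<bar>" by (rule mult_right_mono[OF fl_error_le[OF assms(1)]]) simp
  also have "\<dots> = \<epsilon> * \<bar>x\<bar>" using False by (simp add: abs_divide)
  finally show ?thesis .
qed (use assms in simp)

text \<open>The single update operation of all algorithms involved. A rounding at most doubles a
  value, so \<open>t\<close> is at most \<open>4 * X\<close>, \<open>u - t\<close> at most
  \<open>5 * X\<close> and \<open>w\<close> at most \<open>10 * X\<close>; the two roundings
  contribute \<open>2 * X * \<epsilon>\<close> and \<open>5 * X * \<epsilon>\<close>. The bound 2 on
  \<open>q\<close> allows for a rounded quotient whose exact value is at most 1.\<close>

lemma fl_multiply_subtract:
  assumes "fl \<epsilon> (q * v) t" "fl \<epsilon> (u - t) w" "\<epsilon> \<le> 1" "\<bar>q\<bar> \<le> 2" "\<bar>v\<bar> \<le> X" "\<bar>u\<bar> \<le> X"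
  shows "\<bar>w\<bar> \<le> 10 * X" "\<bar>q * v + w - u\<bar> \<le> 7 * X * \<epsilon>"
proof -
  have qv: "\<bar>q * v\<bar> \<le> 2 * X" unfolding abs_mult using assms by (intro mult_mono) auto
  have ut: "\<bar>u - t\<bar> \<le> 5 * X" using fl_abs_le[OF assms(1,3)] qv assms(6) by linarith
  show "\<bar>w\<bar> \<le> 10 * X" by (rule order_trans[OF fl_abs_le[OF assms(2,3)]]) (use ut in simp)
  have e: "0 \<le> \<epsilon>" using assms(1) by (auto simp: fl_def fl_err_def)
  have "\<epsilon> * \<bar>q * v\<bar> \<le> \<epsilon> * (2 * X)" "\<epsilon> * \<bar>u - t\<bar> \<le> \<epsilon> * (5 * X)"
    using qv ut e by (auto intro: mult_left_mono)
  then show "\<bar>q * v + w - u\<bar> \<le> 7 * X * \<epsilon>"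
    using fl_error_le[OF assms(1)] fl_error_le[OF assms(2)] by (simp add: algebra_simps)
qed

text \<open>A further factor turns the constant \<open>c\<close> into \<open>2 * c + 1\<close>,
  because \<open>1 + \<sigma> x\<close> is at most 2 in absolute value; this recursion produces
  \<open>2 ^ n - 1\<close>. The estimate is linear in \<epsilon> on the whole range up to 1, without
  higher-order terms.\<close>

lemma abs_prod_one_plus_le:
  fixes \<sigma> :: "'a \<Rightarrow> real"
  assumes "finite Q" "\<And>q. q \<in> Q \<Longrightarrow> \<bar>\<sigma> q\<bar> \<le> \<epsilon>" "0 \<le> \<epsilon>" "\<epsilon> \<le> 1"
  shows "\<bar>(\<Prod>q\<in>Q. 1 + \<sigma> q) - 1\<bar> \<le> (2 ^ card Q - 1) * \<epsilon>"
  using assms(1,2)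
proof (induction Q rule: finite_induct)
  case (insert x Q)
  let ?p = "\<Prod>q\<in>Q. 1 + \<sigma> q"
  have IH: "\<bar>?p - 1\<bar> \<le> (2 ^ card Q - 1) * \<epsilon>" using insert by auto
  have s: "\<bar>\<sigma> x\<bar> \<le> \<epsilon>" using insert by auto
  have "\<bar>(\<Prod>q\<in>insert x Q. 1 + \<sigma> q) - 1\<bar> = \<bar>(1 + \<sigma> x) * (?p - 1) + \<sigma> x\<bar>"
    using insert by (simp add: algebra_simps)
  also have "\<dots> \<le> \<bar>1 + \<sigma> x\<bar> * \<bar>?p - 1\<bar> + \<bar>\<sigma> x\<bar>"
    using abs_triangle_ineq[of "(1 + \<sigma> x) * (?p - 1)" "\<sigma> x"] by (simp add: abs_mult)
  also have "\<bar>1 + \<sigma> x\<bar> * \<bar>?p - 1\<bar> \<le> 2 * ((2 ^ card Q - 1) * \<epsilon>)"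
    using s assms(4) IH by (intro mult_mono) auto
  finally have "\<bar>(\<Prod>q\<in>insert x Q. 1 + \<sigma> q) - 1\<bar> \<le> 2 * ((2 ^ card Q - 1) * \<epsilon>) + \<epsilon>" using s by simp
  also have "\<dots> = (2 ^ card (insert x Q) - 1) * \<epsilon>" using insert by (simp add: algebra_simps)
  finally show ?case .
qed simp

lemma abs_mult_prod_one_plus_le:
  fixes \<sigma> :: "'a \<Rightarrow> real"
  assumes "finite Q" "\<And>q. q \<in> Q \<Longrightarrow> \<bar>\<sigma> q\<bar> \<le> \<epsilon>" "0 \<le> \<epsilon>" "\<epsilon> \<le> 1" "\<bar>\<mu>\<bar> \<le> \<epsilon>" "card Q \<le> m"
  shows "\<bar>(1 + \<mu>) * (\<Prod>q\<in>Q. 1 + \<sigma> q) - 1\<bar> \<le> 2 ^ Suc m * \<epsilon>"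
proof -
  let ?p = "\<Prod>q\<in>Q. 1 + \<sigma> q"
  have "(2::real) ^ card Q \<le> 2 ^ m" using assms by simp
  then have p: "\<bar>?p - 1\<bar> \<le> (2 ^ m - 1) * \<epsilon>"
    using abs_prod_one_plus_le[OF assms(1-4)] assms(3)
    by (meson diff_right_mono mult_right_mono order_trans)
  have "\<bar>(1 + \<mu>) * ?p - 1\<bar> = \<bar>(1 + \<mu>) * (?p - 1) + \<mu>\<bar>" by (simp add: algebra_simps)
  also have "\<dots> \<le> \<bar>1 + \<mu>\<bar> * \<bar>?p - 1\<bar> + \<bar>\<mu>\<bar>"
    using abs_triangle_ineq[of "(1 + \<mu>) * (?p - 1)" \<mu>] by (simp add: abs_mult)
  also have "\<bar>1 + \<mu>\<bar> * \<bar>?p - 1\<bar> \<le> 2 * ((2 ^ m - 1) * \<epsilon>)"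
    using assms p by (intro mult_mono) auto
  finally show ?thesis using assms by (simp add: algebra_simps)
qed


section \<open>Triangular solves\<close>

text \<open>An entry of \<open>\<Delta>L\<close> is the entry of \<open>L\<close> times an
  accumulated rounding factor minus 1. The solution and the right-hand side do not occur in it, so
  the bound involves \<open>L\<close> alone.\<close>

lemma forward_subst_error_le:
  assumes fs: "forward_subst \<epsilon> m L b y \<Delta>L" and \<epsilon>: "0 \<le> \<epsilon>" "\<epsilon> \<le> 1" and L: "entries_le m L X"
  shows "entries_le m \<Delta>L (2 ^ Suc m * X * \<epsilon>)"
proof -
  from fs obtain S T \<mu> \<sigma> where
    run: "\<And>r c. c < r \<Longrightarrow> r < m \<Longrightarrow> fl_err \<epsilon> 1 (L $$ (r, c) * y $ c) (\<mu> r c) (T r c)"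
      "\<And>r c. c < r \<Longrightarrow> r < m \<Longrightarrow> fl_err \<epsilon> (-1) (S r c - T r c) (\<sigma> r c) (S r (Suc c))" and
    D: "\<Delta>L = mat m m (\<lambda>(r, c).
          if c < r then L $$ (r, c) * ((1 + \<mu> r c) * (\<Prod>q<c. 1 + \<sigma> r q) - 1)
          else if c = r then L $$ (r, r) * ((\<Prod>q<r. 1 + \<sigma> r q) - 1)
          else 0)"
    unfolding forward_subst_def by blast
  show ?thesis
  proof (rule entries_leI)
    fix r c assume rc: "r < m" "c < m"
    have X: "0 \<le> X" using entries_le_nonneg[OF L] rc by simp
    have le: "\<bar>L $$ (r, c) * d\<bar> \<le> 2 ^ Suc m * X * \<epsilon>" if "\<bar>d\<bar> \<le> 2 ^ Suc m * \<epsilon>" for d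
      using mult_mono[OF entries_leD[OF L rc] that] X by (simp add: abs_mult mult_ac)
    have 1: "\<bar>(1 + \<mu> r c) * (\<Prod>q<c. 1 + \<sigma> r q) - 1\<bar> \<le> 2 ^ Suc m * \<epsilon>" if "c < r"
      using run[of c r] run(2)[of _ r] that rc \<epsilon>
      by (intro abs_mult_prod_one_plus_le) (auto simp: fl_err_def)
    \<comment> \<open>The unit diagonal of \<open>L\<close> is never multiplied with an unknown, so
      the product error is 0 here.\<close>
    have 2: "\<bar>(\<Prod>q<r. 1 + \<sigma> r q) - 1\<bar> \<le> 2 ^ Suc m * \<epsilon>"
      using abs_mult_prod_one_plus_le[of "{..<r}" "\<sigma> r" \<epsilon> 0 m] run(2)[of _ r] rc \<epsilon>
      by (auto simp: fl_err_def)
    show "\<bar>\<Delta>L $$ (r, c)\<bar> \<le> 2 ^ Suc m * X * \<epsilon>"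
      using rc le[OF 1] le[OF 2] X \<epsilon> by (auto simp: D)
  qed (simp add: D)
qed

lemma backward_subst_error_le:
  assumes bs: "backward_subst \<epsilon> m U z x \<Delta>U" and \<epsilon>: "0 \<le> \<epsilon>" "\<epsilon> \<le> 1" and U: "entries_le m U X"
  shows "entries_le m \<Delta>U (2 ^ Suc m * X * \<epsilon>)"
proof -
  from bs obtain S T \<mu> \<sigma> \<delta> where
    run: "\<And>r. r < m \<Longrightarrow> fl_err \<epsilon> (-1) (S r m / U $$ (r, r)) (\<delta> r) (x $ r)"
      "\<And>r c. r < m \<Longrightarrow> c \<in> {Suc r..<m} \<Longrightarrow> fl_err \<epsilon> 1 (U $$ (r, c) * x $ c) (\<mu> r c) (T r c)"
      "\<And>r c. r < m \<Longrightarrow> c \<in> {Suc r..<m} \<Longrightarrow> fl_err \<epsilon> (-1) (S r c - T r c) (\<sigma> r c) (S r (Suc c))" and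
    D: "\<Delta>U = mat m m (\<lambda>(r, c).
          if r < c then U $$ (r, c) * ((1 + \<mu> r c) * (\<Prod>q\<in>{Suc r..<c}. 1 + \<sigma> r q) - 1)
          else if c = r then U $$ (r, r) * ((1 + \<delta> r) * (\<Prod>q\<in>{Suc r..<m}. 1 + \<sigma> r q) - 1)
          else 0)"
    unfolding backward_subst_def by blast
  show ?thesis
  proof (rule entries_leI)
    fix r c assume rc: "r < m" "c < m"
    have X: "0 \<le> X" using entries_le_nonneg[OF U] rc by simp
    have le: "\<bar>U $$ (r, c) * d\<bar> \<le> 2 ^ Suc m * X * \<epsilon>" if "\<bar>d\<bar> \<le> 2 ^ Suc m * \<epsilon>" for d
      using mult_mono[OF entries_leD[OF U rc] that] X by (simp add: abs_mult mult_ac)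
    have 1: "\<bar>(1 + \<mu> r c) * (\<Prod>q\<in>{Suc r..<c}. 1 + \<sigma> r q) - 1\<bar> \<le> 2 ^ Suc m * \<epsilon>" if "r < c"
      using run(2)[of r c] run(3)[of r] that rc \<epsilon>
      by (intro abs_mult_prod_one_plus_le) (auto simp: fl_err_def)
    have 2: "\<bar>(1 + \<delta> r) * (\<Prod>q\<in>{Suc r..<m}. 1 + \<sigma> r q) - 1\<bar> \<le> 2 ^ Suc m * \<epsilon>"
      using run(1)[of r] run(3)[of r] rc \<epsilon>
      by (intro abs_mult_prod_one_plus_le) (auto simp: fl_err_def)
    show "\<bar>\<Delta>U $$ (r, c)\<bar> \<le> 2 ^ Suc m * X * \<epsilon>"
      using rc le[OF 1] le[OF 2] X \<epsilon> by (auto simp: D)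
  qed (simp add: D)
qed

text \<open>The residual of the solve contains \<open>\<Delta>L *\<^sub>v y\<close>, and the column
  appended to \<open>U\<close> is computed from \<open>y\<close>; both require \<open>y\<close> to
  be bounded independently of \<epsilon>. Each of the fewer than \<open>m\<close> subtractions in a
  row costs a factor 10, and the rows build on each other, hence the nested power.\<close>

lemma forward_subst_solution_le:
  assumes fs: "forward_subst \<epsilon> m L b y \<Delta>L" and \<epsilon>: "\<epsilon> \<le> 1"
    and L: "entries_le m L 2" and b: "vec_entries_le m b X"
  shows "vec_entries_le m y ((10 ^ m) ^ m * X)"
proof -
  from fs obtain S T where y: "y \<in> carrier_vec m" and
    run: "\<And>r. r < m \<Longrightarrow> S r 0 = b $ r" "\<And>r. r < m \<Longrightarrow> y $ r = S r r"
      "\<And>r c. c < r \<Longrightarrow> r < m \<Longrightarrow> fl \<epsilon> (L $$ (r, c) * y $ c) (T r c)"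
      "\<And>r c. c < r \<Longrightarrow> r < m \<Longrightarrow> fl \<epsilon> (S r c - T r c) (S r (Suc c))"
    unfolding forward_subst_def by blast
  \<comment> \<open>Inner induction along one row, for a fixed bound \<open>Y\<close> on the
    unknowns already computed. The outer induction over the rows uses it with the bound of the
    previous row as \<open>Y\<close>.\<close>
  have S: "\<bar>S r c\<bar> \<le> 10 ^ c * Y"
    if Y: "\<And>q. q < r \<Longrightarrow> \<bar>y $ q\<bar> \<le> Y" and "X \<le> Y" and "c \<le> r" and r: "r < m" for r c Y
    using \<open>c \<le> r\<close>
  proof (induction c)
    case 0
    then show ?case using run(1)[OF r] vec_entries_leD[OF b r] \<open>X \<le> Y\<close> by simp
  next
    case (Suc c)
    have Y0: "0 \<le> Y" using vec_entries_leD[OF b r] \<open>X \<le> Y\<close> by linarith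
    have "Y \<le> 10 ^ c * Y" using mult_right_mono[of 1 "10 ^ c" Y] Y0 by simp
    then show ?case
      using fl_multiply_subtract(1)[OF run(3,4) \<epsilon>, of c r "10 ^ c * Y"] Suc Y[of c] r
        entries_leD[OF L, of r c] by simp
  qed
  have "\<bar>y $ r\<bar> \<le> (10 ^ m) ^ r * X" if "r < m" for r
    using that
  proof (induction r rule: less_induct)
    case (less r)
    have X: "0 \<le> X" using vec_entries_leD[OF b less.prems] by linarith
    show ?case
    proof (cases r)
      case 0
      then show ?thesis using run(1,2)[OF less.prems] vec_entries_leD[OF b less.prems] by simp
    next
      case (Suc r')
      let ?Y = "(10 ^ m) ^ r' * X"
      have "\<bar>y $ q\<bar> \<le> ?Y" if "q < r" for q
      proof -
        have "(10 ^ m) ^ q * X \<le> ?Y"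
          using that Suc X by (intro mult_right_mono power_increasing) auto
        then show ?thesis using less.IH[OF that] that less.prems by simp
      qed
      moreover have "X \<le> ?Y" using mult_right_mono[of 1 "(10 ^ m) ^ r'" X] X by simp
      ultimately have "\<bar>y $ r\<bar> \<le> 10 ^ r * ?Y"
        using S[of r ?Y r] run(2)[OF less.prems] less.prems by simp
      also have "\<dots> \<le> 10 ^ m * ?Y" using less.prems X by (intro mult_right_mono power_increasing) auto
      finally show ?thesis using Suc by (simp add: mult_ac)
    qed
  qed
  moreover have "(10 ^ m) ^ r * X \<le> (10 ^ m) ^ m * X" if "r < m" for r
    using that vec_entries_leD[OF b that] by (intro mult_right_mono power_increasing) auto
  ultimately show ?thesis using y by (intro vec_entries_leI) force+
qed


section \<open>Products of elementary factors\<close>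

text \<open>One flat list of factors follows the recursion of \<open>apply_factors\<close>, whereas
  \<open>G_mat\<close> groups the same factors by updates.\<close>

fun factor_prod :: "nat \<Rightarrow> (nat \<times> bool \<times> real) list \<Rightarrow> real mat" where
  "factor_prod m [] = 1\<^sub>m m"
| "factor_prod m ((j, s, g) # fs) = swap_mat m j s * Gamma_inv_mat m j g * factor_prod m fs"

lemma Gamma_inv_mat_carrier: "Gamma_inv_mat m j g \<in> carrier_mat m m"
  by (simp add: Gamma_inv_mat_def)

lemma swap_Gamma_inv_carrier: "swap_mat m j s * Gamma_inv_mat m j g \<in> carrier_mat m m"
  by (rule mult_carrier_mat[OF swap_mat_carrier Gamma_inv_mat_carrier])

lemma factor_prod_carrier: "factor_prod m fs \<in> carrier_mat m m"
  by (induction m fs rule: factor_prod.induct) (auto intro!: mult_carrier_mat[OF swap_Gamma_inv_carrier])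

lemma factor_prod_append: "factor_prod m (fs @ fs') = factor_prod m fs * factor_prod m fs'"
proof (induction fs)
  case Nil
  show ?case using left_mult_one_mat[OF factor_prod_carrier[of m fs']] by simp
next
  case (Cons f fs)
  obtain j s g where f: "f = (j, s, g)" by (cases f) auto
  show ?case
    unfolding append_Cons f factor_prod.simps Cons
    by (rule assoc_mult_mat[symmetric, OF swap_Gamma_inv_carrier factor_prod_carrier factor_prod_carrier])
qed

lemma C_mat_eq_factor_prod:
  "C_mat m l sw g k = factor_prod m (map (\<lambda>j. (j, sw k j, g k j)) [l k..<m - 1])"
proof -
  have "foldr (*) (map (\<lambda>j. swap_mat m j (sw k j) * Gamma_inv_mat m j (g k j)) js) (1\<^sub>m m) =
    factor_prod m (map (\<lambda>j. (j, sw k j, g k j)) js)" for js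
    by (induction js) auto
  then show ?thesis unfolding C_mat_def .
qed

lemma C_mat_carrier: "C_mat m l sw g k \<in> carrier_mat m m"
  unfolding C_mat_eq_factor_prod by (rule factor_prod_carrier)

lemma G_mat_eq_factor_prod: "G_mat m l sw g k = factor_prod m (factors_of_G m l sw g k)"
proof (induction k)
  case 0
  show ?case by (simp add: factors_of_G_def)
next
  case (Suc k)
  have "factors_of_G m l sw g (Suc k) =
    factors_of_G m l sw g k @ map (\<lambda>j. (j, sw (Suc k) j, g (Suc k) j)) [l (Suc k)..<m - 1]"
    by (simp add: factors_of_G_def)
  then show ?case unfolding G_mat.simps Suc C_mat_eq_factor_prod by (simp only: factor_prod_append)
qed

lemma swap_mat_index:
  assumes "Suc j < m" "M \<in> carrier_mat m m" "r < m" "c < m"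
  shows "(swap_mat m j s * M) $$ (r, c) =
    M $$ (if s then (if r = j then Suc j else if r = Suc j then j else r) else r, c)"
proof (cases s)
  case True
  then show ?thesis
    using assms swaprows_mat[OF assms(2), of j "Suc j", symmetric] by (auto simp: swap_mat_def)
qed (use assms in \<open>simp add: swap_mat_def\<close>)

lemma entries_le_swap_mult:
  assumes "Suc j < m" "entries_le m M X"
  shows "entries_le m (swap_mat m j s * M) X"
proof (rule entries_leI)
  show "swap_mat m j s * M \<in> carrier_mat m m"
    by (rule mult_carrier_mat[OF swap_mat_carrier entries_le_carrier[OF assms(2)]])
qed (use assms in \<open>auto simp: swap_mat_index[OF assms(1) entries_le_carrier[OF assms(2)]]
    intro!: entries_leD[OF assms(2)]\<close>)

lemma entries_le_Gamma_inv:
  assumes "\<bar>g\<bar> \<le> 1"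
  shows "entries_le m (Gamma_inv_mat m j g) 1"
  using assms by (auto simp: entries_le_def Gamma_inv_mat_def)

lemma entries_le_perturbed_Gamma_inv:
  assumes "\<bar>g\<bar> \<le> 1" "\<bar>\<mu>\<bar> \<le> \<epsilon>" "\<bar>\<sigma>\<bar> \<le> \<epsilon>" "\<epsilon> \<le> 1"
  shows "entries_le m (perturbed_Gamma_inv m j g \<mu> \<sigma>) 2"
    and "entries_le m (perturbed_Gamma_inv m j g \<mu> \<sigma> - Gamma_inv_mat m j g) \<epsilon>"
proof -
  have 1: "\<bar>g * (1 + \<mu>)\<bar> \<le> 1 * 2" unfolding abs_mult using assms by (intro mult_mono) auto
  have 2: "\<bar>g * \<mu>\<bar> \<le> 1 * \<epsilon>" unfolding abs_mult using assms by (intro mult_mono) auto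
  show "entries_le m (perturbed_Gamma_inv m j g \<mu> \<sigma>) 2"
    using 1 assms by (auto simp: entries_le_def perturbed_Gamma_inv_def)
  show "entries_le m (perturbed_Gamma_inv m j g \<mu> \<sigma> - Gamma_inv_mat m j g) \<epsilon>"
  proof (rule entries_leI)
    fix r c assume rc: "r < m" "c < m"
    have "(perturbed_Gamma_inv m j g \<mu> \<sigma> - Gamma_inv_mat m j g) $$ (r, c) =
      (if r = Suc j \<and> c = j then g * \<mu> else if r = Suc j \<and> c = Suc j then \<sigma> else 0)"
      using rc by (simp add: perturbed_Gamma_inv_def Gamma_inv_mat_def distrib_left)
    then show "\<bar>(perturbed_Gamma_inv m j g \<mu> \<sigma> - Gamma_inv_mat m j g) $$ (r, c)\<bar> \<le> \<epsilon>"
      using 2 assms order_trans[OF abs_ge_zero assms(2)] by simp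
  qed (simp add: Gamma_inv_mat_carrier minus_carrier_mat)
qed

definition valid_factors :: "nat \<Rightarrow> (nat \<times> bool \<times> real) list \<Rightarrow> bool" where
  "valid_factors m fs \<longleftrightarrow> (\<forall>(j, s, g)\<in>set fs. Suc j < m \<and> \<bar>g\<bar> \<le> 1)"

lemma valid_factors_Cons:
  "valid_factors m ((j, s, g) # fs) \<longleftrightarrow> Suc j < m \<and> \<bar>g\<bar> \<le> 1 \<and> valid_factors m fs"
  by (auto simp: valid_factors_def)

lemma entries_le_factor_prod:
  assumes "valid_factors m fs"
  shows "entries_le m (factor_prod m fs) (real m ^ length fs)"
  using assms
proof (induction fs)
  case Nil
  show ?case by (simp add: entries_le_one)
next
  case (Cons f fs)
  obtain j s g where f: "f = (j, s, g)" by (cases f) auto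
  have v: "Suc j < m" "\<bar>g\<bar> \<le> 1" "valid_factors m fs"
    using Cons.prems by (auto simp: f valid_factors_Cons)
  show ?case
    using entries_le_mult[OF entries_le_swap_mult[OF v(1) entries_le_Gamma_inv[OF v(2)]] Cons.IH[OF v(3)]]
    by (simp add: f)
qed

text \<open>A stored factor permutes two entries and recomputes one of them by a multiplication and
  a subtraction, at the cost of a factor 10.\<close>

lemma apply_factors_solution_le:
  assumes "apply_factors \<epsilon> m fs v z M" "valid_factors m fs" "vec_entries_le m v X" "\<epsilon> \<le> 1"
  shows "vec_entries_le m z (10 ^ length fs * X)"
  using assms
proof (induction fs arbitrary: v M X)
  case (Cons f fs)
  obtain j s g where f: "f = (j, s, g)" by (cases f) auto
  have v: "Suc j < m" "\<bar>g\<bar> \<le> 1" "valid_factors m fs"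
    using Cons.prems by (auto simp: f valid_factors_Cons)
  define u where "u = swap_mat m j s *\<^sub>v v"
  from Cons.prems(1) obtain t w M' where
    t: "fl \<epsilon> (g * u $ j) t" and w: "fl \<epsilon> (u $ Suc j - t) w" and
    rec: "apply_factors \<epsilon> m fs (vec m (\<lambda>r. if r = Suc j then w else u $ r)) z M'"
    unfolding f apply_factors.simps Let_def u_def[symmetric] by blast
  have vc: "v \<in> carrier_vec m" using Cons.prems(3) by (rule vec_entries_le_carrier)
  have "u $ r = v $ (if s then (if r = j then Suc j else if r = Suc j then j else r) else r)"
    if "r < m" for r
  proof (cases s)
    case True
    let ?r = "if r = j then Suc j else if r = Suc j then j else r"
    have "u $ r = (\<Sum>q<m. swap_mat m j s $$ (r, q) * v $ q)"
      unfolding u_def by (rule index_mult_mat_vec_sum[OF swap_mat_carrier vc that])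
    also have "\<dots> = (\<Sum>q\<in>{?r}. swap_mat m j s $$ (r, q) * v $ q)"
      by (rule sum.mono_neutral_right) (use that v(1) True in \<open>auto simp: swap_mat_def\<close>)
    also have "\<dots> = v $ ?r" using that v(1) True by (auto simp: swap_mat_def)
    finally show ?thesis using True by simp
  qed (use vc in \<open>simp add: u_def swap_mat_def\<close>)
  then have u: "\<bar>u $ r\<bar> \<le> X" if "r < m" for r
    using that v(1) vec_entries_leD[OF Cons.prems(3)] by simp
  have X: "0 \<le> X" using u[OF v(1)] by linarith
  have "\<bar>w\<bar> \<le> 10 * X"
    using fl_multiply_subtract(1)[OF t w Cons.prems(4)] v u[of j] u[of "Suc j"] by simp
  then have "vec_entries_le m (vec m (\<lambda>r. if r = Suc j then w else u $ r)) (10 * X)"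
    using u X by (force simp: vec_entries_le_def)
  from Cons.IH[OF rec v(3) this Cons.prems(4)] show ?case by (simp add: f mult_ac)
qed simp

lemma apply_factors_carrier: "apply_factors \<epsilon> m fs v z M \<Longrightarrow> M \<in> carrier_mat m m"
proof (induction \<epsilon> m fs v z M rule: apply_factors.induct)
  case (2 \<epsilon> m j s g fs v z M)
  then show ?case
    by (auto simp: Let_def perturbed_Gamma_inv_def
        intro!: mult_carrier_mat[of _ m m] swap_mat_carrier)
qed simp

text \<open>The exact factors are exchanged for the perturbed ones one at a time. With
  \<open>S\<close>, \<open>N\<close>, \<open>\<Gamma>\<close> the swap, the perturbed and the exact
  inverse factor, and \<open>F\<close> the exact remaining product, the error is
  \<open>S * N * (M' - F) + S * (N - \<Gamma>) * F\<close>. Entries of \<open>N\<close> are at most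
  2, so the old error grows by \<open>2 * m\<close>; weakening the bound on \<open>F\<close> from
  \<open>m ^ n\<close> to \<open>(2 * m) ^ n\<close> gives the new error the same shape.\<close>

lemma apply_factors_error_le:
  assumes "apply_factors \<epsilon> m fs v z M" "valid_factors m fs" "0 \<le> \<epsilon>" "\<epsilon> \<le> 1"
  shows "entries_le m (M - factor_prod m fs) (real (length fs) * real (2 * m) ^ length fs * \<epsilon>)"
  using assms
proof (induction fs arbitrary: v M)
  case Nil
  then show ?case by (auto simp: entries_le_def)
next
  case (Cons f fs)
  obtain j s g where f: "f = (j, s, g)" by (cases f) auto
  have v: "Suc j < m" "\<bar>g\<bar> \<le> 1" "valid_factors m fs"
    using Cons.prems by (auto simp: f valid_factors_Cons)
  define u where "u = swap_mat m j s *\<^sub>v v"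
  from Cons.prems(1) obtain t w \<mu> \<sigma> M' where
    err: "fl_err \<epsilon> 1 (g * u $ j) \<mu> t" "fl_err \<epsilon> (-1) (u $ Suc j - t) \<sigma> w" and
    rec: "apply_factors \<epsilon> m fs (vec m (\<lambda>r. if r = Suc j then w else u $ r)) z M'" and
    M: "M = swap_mat m j s * perturbed_Gamma_inv m j g \<mu> \<sigma> * M'"
    unfolding f apply_factors.simps Let_def u_def[symmetric] by blast
  define n where "n = length fs"
  let ?S = "swap_mat m j s" and ?F = "factor_prod m fs"
  let ?N = "perturbed_Gamma_inv m j g \<mu> \<sigma>" and ?\<Gamma> = "Gamma_inv_mat m j g"
  have IH: "entries_le m (M' - ?F) (real n * real (2 * m) ^ n * \<epsilon>)"
    unfolding n_def by (rule Cons.IH[OF rec v(3) Cons.prems(3,4)])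
  have ms: "\<bar>\<mu>\<bar> \<le> \<epsilon>" "\<bar>\<sigma>\<bar> \<le> \<epsilon>" using err by (auto simp: fl_err_def)
  note N = entries_le_perturbed_Gamma_inv[OF v(2) ms Cons.prems(4), of m j]
  have F: "entries_le m ?F (real (2 * m) ^ n)"
    using entries_le_factor_prod[OF v(3)] unfolding n_def
    by (rule entries_le_mono) (intro power_mono; simp)
  have Mc: "M' \<in> carrier_mat m m" by (rule apply_factors_carrier[OF rec])
  note c = swap_mat_carrier[of m j s] entries_le_carrier[OF N(1)] Gamma_inv_mat_carrier[of m j g]
    entries_le_carrier[OF F] Mc
  have "M - factor_prod m (f # fs) = ?S * ?N * (M' - ?F) + ?S * (?N - ?\<Gamma>) * ?F"
  proof -
    have SN: "?S * ?N \<in> carrier_mat m m" and SG: "?S * ?\<Gamma> \<in> carrier_mat m m"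
      using c by (auto intro: mult_carrier_mat)
    have "?S * ?N * (M' - ?F) = ?S * ?N * M' - ?S * ?N * ?F"
      using SN c by (intro mult_minus_distrib_mat) auto
    moreover have "?S * (?N - ?\<Gamma>) * ?F = ?S * ?N * ?F - ?S * ?\<Gamma> * ?F"
    proof -
      have "?S * (?N - ?\<Gamma>) = ?S * ?N - ?S * ?\<Gamma>" using c by (intro mult_minus_distrib_mat) auto
      then show ?thesis using minus_mult_distrib_mat[OF SN SG c(4)] by simp
    qed
    moreover have "?S * ?N * M' \<in> carrier_mat m m" "?S * ?N * ?F \<in> carrier_mat m m"
      "?S * ?\<Gamma> * ?F \<in> carrier_mat m m"
      using SN SG c by (auto intro: mult_carrier_mat)
    ultimately show ?thesis
      unfolding M f factor_prod.simps by (intro eq_matI) auto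
  qed
  moreover have "entries_le m (?S * ?N * (M' - ?F) + ?S * (?N - ?\<Gamma>) * ?F)
    (real m * 2 * (real n * real (2 * m) ^ n * \<epsilon>) + real m * \<epsilon> * real (2 * m) ^ n)"
    by (intro entries_le_add entries_le_mult entries_le_swap_mult N IH F v)
  moreover have "real m * 2 * (real n * real (2 * m) ^ n * \<epsilon>) + real m * \<epsilon> * real (2 * m) ^ n
    \<le> real (length (f # fs)) * real (2 * m) ^ length (f # fs) * \<epsilon>"
    using Cons.prems(3) by (simp add: n_def algebra_simps)
  ultimately show ?case by (simp add: entries_le_mono)
qed


section \<open>Gaussian elimination with partial pivoting\<close>

text \<open>The factors \<open>L\<close> and \<open>U\<close> stored in the in-place array \<open>W\<close> after \<open>k\<close> elimination steps: only
  the first \<open>k\<close> columns hold multipliers below the diagonal.\<close>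

definition stored_L :: "nat \<Rightarrow> nat \<Rightarrow> real mat \<Rightarrow> real mat" where
  "stored_L m k W = mat m m (\<lambda>(r, c). if r = c then 1 else if c < k \<and> c < r then W $$ (r, c) else 0)"

definition stored_U :: "nat \<Rightarrow> nat \<Rightarrow> real mat \<Rightarrow> real mat" where
  "stored_U m k W = mat m m (\<lambda>(r, c). if c < k \<and> c < r then 0 else W $$ (r, c))"

lemma stored_carrier: "stored_L m k W \<in> carrier_mat m m" "stored_U m k W \<in> carrier_mat m m"
  by (auto simp: stored_L_def stored_U_def)

lemma entries_le_swaprows_mult:
  assumes "k < m" "p < m" "entries_le m M X"
  shows "entries_le m (swaprows_mat m k p * M) X"
  using assms swaprows_mat[OF entries_le_carrier[OF assms(3)] assms(1,2), symmetric]
  by (auto simp: entries_le_def)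

text \<open>\<open>S * (L * U) = (S * L * S) * (S * U)\<close> for the involution \<open>S\<close>.
  Columns \<open>k\<close> and \<open>p\<close> of the stored \<open>L\<close> are still unit
  vectors, so conjugation by \<open>S\<close> interchanges the multipliers in the earlier columns
  and puts the ones back on the diagonal: it is the stored \<open>L\<close> of the swapped
  array.\<close>

lemma stored_swap:
  assumes W: "W \<in> carrier_mat m m" and kp: "k \<le> p" "p < m"
  defines "V \<equiv> swaprows_mat m k p * W"
  shows "swaprows_mat m k p * (stored_L m k W * stored_U m k W) = stored_L m k V * stored_U m k V"
proof -
  let ?S = "swaprows_mat m k p" and ?L = "stored_L m k W" and ?U = "stored_U m k W"
  have km: "k < m" using kp by simp
  have S: "?S \<in> carrier_mat m m" by simp
  note c = S stored_carrier[of m k W]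
  have V: "V = swaprows k p W" unfolding V_def using swaprows_mat[OF W km kp(2)] by simp
  have L: "?S * ?L * ?S = stored_L m k V"
  proof -
    have "?S * ?L * ?S = swapcols k p (swaprows k p ?L)"
      unfolding swaprows_mat[OF c(2) km kp(2)]
      by (rule swapcols_mat[symmetric, OF mult_carrier_mat[OF c(1,2)] km kp(2)])
    also have "\<dots> = stored_L m k V"
      using km kp W by (intro eq_matI) (auto simp: V stored_L_def)
    finally show ?thesis .
  qed
  have U: "?S * ?U = stored_U m k V"
  proof -
    have "?S * ?U = swaprows k p ?U" using swaprows_mat[OF c(3) km kp(2)] by simp
    also have "\<dots> = stored_U m k V"
      using km kp W by (intro eq_matI) (auto simp: V stored_U_def)
    finally show ?thesis .
  qed
  have SL: "?S * ?L \<in> carrier_mat m m" using c by auto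
  have SU: "?S * ?U \<in> carrier_mat m m" using c by auto
  have "stored_L m k V * stored_U m k V = ?S * ?L * ?S * (?S * ?U)" unfolding L U ..
  also have "\<dots> = ?S * ?L * (?S * (?S * ?U))" by (rule assoc_mult_mat[OF SL S SU])
  also have "?S * (?S * ?U) = ?S * ?S * ?U" by (rule assoc_mult_mat[OF S S c(3), symmetric])
  also have "\<dots> = ?U" using swaprows_mat_inv[OF km kp(2), where 'a = real] c(3) by simp
  also have "?S * ?L * ?U = ?S * (?L * ?U)" by (rule assoc_mult_mat[OF S c(2,3)])
  finally show ?thesis by simp
qed

text \<open>After the swap, the products before and after the step agree in the rows up to
  \<open>k\<close> and in the columns before \<open>k\<close>. Below row \<open>k\<close>, the error
  in column \<open>k\<close> is that of the quotient, and in later columns that of one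
  multiplication and one subtraction. The stored factors are bounded instead of the array
  \<open>W\<close> because multipliers and eliminated entries obey different bounds.\<close>

lemma gepp_step_bounds:
  assumes step: "gepp_step \<epsilon> m k p W W'" and W: "W \<in> carrier_mat m m" and \<epsilon>0: "0 \<le> \<epsilon>" and \<epsilon>: "\<epsilon> \<le> 1"
    and L: "entries_le m (stored_L m k W) 2" and U: "entries_le m (stored_U m k W) X"
  shows "entries_le m (stored_L m (Suc k) W') 2"
    and "entries_le m (stored_U m (Suc k) W') (10 * X)"
    and "entries_le m (stored_L m (Suc k) W' * stored_U m (Suc k) W' -
      swaprows_mat m k p * (stored_L m k W * stored_U m k W)) (7 * X * \<epsilon>)"
proof -
  define V where "V = swaprows_mat m k p * W"
  have kp: "k \<le> p" "p < m" and piv: "\<And>r. k \<le> r \<Longrightarrow> r < m \<Longrightarrow> \<bar>W $$ (r, k)\<bar> \<le> \<bar>W $$ (p, k)\<bar>"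
    and W': "W' \<in> carrier_mat m m"
    and keep: "\<And>r c. r < m \<Longrightarrow> c < m \<Longrightarrow> r \<le> k \<or> c < k \<Longrightarrow> W' $$ (r, c) = V $$ (r, c)"
    and mult: "\<And>r. r < m \<Longrightarrow> k < r \<Longrightarrow> fl \<epsilon> (V $$ (r, k) / V $$ (k, k)) (W' $$ (r, k))"
    and elim: "\<And>r c. r < m \<Longrightarrow> c < m \<Longrightarrow> k < r \<Longrightarrow> k < c \<Longrightarrow>
      \<exists>t. fl \<epsilon> (W' $$ (r, k) * V $$ (k, c)) t \<and> fl \<epsilon> (V $$ (r, c) - t) (W' $$ (r, c))"
  proof -
    have s: "k \<le> p" "p < m" "\<forall>r\<in>{k..<m}. \<bar>W $$ (r, k)\<bar> \<le> \<bar>W $$ (p, k)\<bar>" "W' \<in> carrier_mat m m"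
      "\<And>r c. r < m \<Longrightarrow> c < m \<Longrightarrow>
        if r \<le> k \<or> c < k then W' $$ (r, c) = V $$ (r, c)
        else if c = k then fl \<epsilon> (V $$ (r, k) / V $$ (k, k)) (W' $$ (r, k))
        else \<exists>t. fl \<epsilon> (W' $$ (r, k) * V $$ (k, c)) t \<and> fl \<epsilon> (V $$ (r, c) - t) (W' $$ (r, c))"
      using step unfolding gepp_step_def Let_def V_def[symmetric] by blast+
    show "k \<le> p" "p < m" "W' \<in> carrier_mat m m" by fact+
    show "\<bar>W $$ (r, k)\<bar> \<le> \<bar>W $$ (p, k)\<bar>" if "k \<le> r" "r < m" for r using s(3) that by simp
    show "W' $$ (r, c) = V $$ (r, c)" if "r < m" "c < m" "r \<le> k \<or> c < k" for r c
      using s(5)[of r c] that by simp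
    show "fl \<epsilon> (V $$ (r, k) / V $$ (k, k)) (W' $$ (r, k))" if "r < m" "k < r" for r
      using s(5)[of r k] that by simp
    show "\<exists>t. fl \<epsilon> (W' $$ (r, k) * V $$ (k, c)) t \<and> fl \<epsilon> (V $$ (r, c) - t) (W' $$ (r, c))"
      if "r < m" "c < m" "k < r" "k < c" for r c
      using s(5)[of r c] that by simp
  qed
  have km: "k < m" using kp by simp
  have V: "V = swaprows k p W" unfolding V_def using swaprows_mat[OF W km kp(2)] by simp
  have Lb: "\<bar>V $$ (r, c)\<bar> \<le> 2" if "r < m" "c < k" "c < r" for r c
    using that kp km W entries_leD[OF L, of r c] entries_leD[OF L, of k c] entries_leD[OF L, of p c]
    by (auto simp: V stored_L_def)
  have Ub: "\<bar>V $$ (r, c)\<bar> \<le> X" if "r < m" "c < m" "r \<le> c \<or> k \<le> c" for r c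
    using that kp km W entries_leD[OF U, of r c] entries_leD[OF U, of k c] entries_leD[OF U, of p c]
    by (auto simp: V stored_U_def split: if_splits)
  have X: "0 \<le> X" using Ub[OF km km] by simp
  have pivV: "\<bar>V $$ (r, k)\<bar> \<le> \<bar>V $$ (k, k)\<bar>" if "r < m" "k \<le> r" for r
    using that kp km W piv[of r] piv[of k] by (auto simp: V)
  \<comment> \<open>The exact quotient is at most 1 by pivoting, also for a zero pivot, where its
    value is 0. Rounding may double it, which is why \<open>L\<close> is bounded by 2.\<close>
  have l2: "\<bar>W' $$ (r, k)\<bar> \<le> 2" if "r < m" "k < r" for r
  proof -
    have "\<bar>V $$ (r, k) / V $$ (k, k)\<bar> \<le> 1"
      using pivV[of r] that by (simp add: divide_le_eq_1)
    then show ?thesis using fl_abs_le[OF mult[OF that] \<epsilon>] by linarith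
  qed
  have upd: "\<bar>W' $$ (r, c)\<bar> \<le> 10 * X"
    "\<bar>W' $$ (r, k) * V $$ (k, c) + W' $$ (r, c) - V $$ (r, c)\<bar> \<le> 7 * X * \<epsilon>"
    if rc: "r < m" "c < m" "k < r" "k < c" for r c
  proof -
    obtain t where "fl \<epsilon> (W' $$ (r, k) * V $$ (k, c)) t" "fl \<epsilon> (V $$ (r, c) - t) (W' $$ (r, c))"
      using elim[OF rc] by blast
    from fl_multiply_subtract[OF this \<epsilon> l2 Ub Ub] rc km
    show "\<bar>W' $$ (r, c)\<bar> \<le> 10 * X"
      "\<bar>W' $$ (r, k) * V $$ (k, c) + W' $$ (r, c) - V $$ (r, c)\<bar> \<le> 7 * X * \<epsilon>" by auto
  qed
  show "entries_le m (stored_L m (Suc k) W') 2"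
  proof (rule entries_leI[OF stored_carrier(1)])
    fix r c assume rc: "r < m" "c < m"
    then show "\<bar>stored_L m (Suc k) W' $$ (r, c)\<bar> \<le> 2"
      using l2[of r] Lb[of r c] keep[of r c] by (cases "c = k") (auto simp: stored_L_def)
  qed
  show "entries_le m (stored_U m (Suc k) W') (10 * X)"
  proof (rule entries_leI[OF stored_carrier(2)])
    fix r c assume rc: "r < m" "c < m"
    consider "c < Suc k" "c < r" | "k < r" "k < c" | "r \<le> k" "r \<le> c \<or> k \<le> c" by linarith
    then show "\<bar>stored_U m (Suc k) W' $$ (r, c)\<bar> \<le> 10 * X"
    proof cases
      case 3
      then have "\<bar>stored_U m (Suc k) W' $$ (r, c)\<bar> \<le> X"
        using rc keep[of r c] Ub[of r c] X by (auto simp: stored_U_def)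
      then show ?thesis using X by linarith
    qed (use rc X upd(1)[of r c] in \<open>auto simp: stored_U_def\<close>)
  qed
  let ?L' = "stored_L m (Suc k) W'" and ?U' = "stored_U m (Suc k) W'"
  let ?L = "stored_L m k V" and ?U = "stored_U m k V"
  have "entries_le m (?L' * ?U' - ?L * ?U) (7 * X * \<epsilon>)"
  proof (rule entries_leI)
    show "?L' * ?U' - ?L * ?U \<in> carrier_mat m m"
      by (rule minus_carrier_mat[OF mult_carrier_mat[OF stored_carrier]])
    fix r c assume rc: "r < m" "c < m"
    let ?d = "\<lambda>q. ?L' $$ (r, q) * ?U' $$ (q, c) - ?L $$ (r, q) * ?U $$ (q, c)"
    have "(?L' * ?U' - ?L * ?U) $$ (r, c) = (?L' * ?U') $$ (r, c) - (?L * ?U) $$ (r, c)"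
      using rc stored_carrier[of m k V] by (intro index_minus_mat(1)) auto
    also have "\<dots> = (\<Sum>q<m. ?d q)"
      using index_mult_mat_sum[OF stored_carrier rc, of "Suc k" W' "Suc k" W']
        index_mult_mat_sum[OF stored_carrier rc, of k V k V] by (simp only: sum_subtractf)
    finally have sum: "(?L' * ?U' - ?L * ?U) $$ (r, c) = (\<Sum>q<m. ?d q)" .
    show "\<bar>(?L' * ?U' - ?L * ?U) $$ (r, c)\<bar> \<le> 7 * X * \<epsilon>"
    proof (cases "k < r")
      case False
      have "?d q = 0" if "q < m" for q
        using that rc False keep[of r q] keep[of q c] km by (auto simp: stored_L_def stored_U_def)
      then have "(\<Sum>q<m. ?d q) = 0" by simp
      then show ?thesis unfolding sum using X \<epsilon>0 by simp
    next
      case True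
      \<comment> \<open>Only the column of new multipliers, \<open>q = k\<close>, and the unit
        diagonal of \<open>L\<close>, \<open>q = r\<close>, can contribute: before \<open>k\<close>
        nothing has changed, and elsewhere row \<open>r\<close> of both lower factors is
        zero.\<close>
      have "(\<Sum>q<m. ?d q) = (\<Sum>q\<in>{k, r}. ?d q)"
      proof (rule sum.mono_neutral_right)
        show "\<forall>q\<in>{..<m} - {k, r}. ?d q = 0"
          using rc True keep[of r] keep[of _ c] km by (auto simp: stored_L_def stored_U_def)
      qed (use rc km in auto)
      also have "\<dots> = ?d k + ?d r" using True by simp
      finally have d: "(\<Sum>q<m. ?d q) = ?d k + ?d r" .
      consider "c < k" | "c = k" | "k < c" by linarith
      then show ?thesis
      proof cases
        case 1
        then have "?d k + ?d r = 0"
          using rc True km by (simp add: stored_L_def stored_U_def)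
        then show ?thesis unfolding sum d using X \<epsilon>0 by simp
      next
        case 2
        then have "?d k + ?d r = W' $$ (r, k) * V $$ (k, k) - V $$ (r, k)"
          using rc True km keep[of k k] by (simp add: stored_L_def stored_U_def)
        moreover have "\<bar>\<dots>\<bar> \<le> \<epsilon> * \<bar>V $$ (r, k)\<bar>"
          using fl_quotient_times_divisor[OF mult pivV] rc True by simp
        moreover have "\<epsilon> * \<bar>V $$ (r, k)\<bar> \<le> \<epsilon> * (7 * X)"
          using Ub[of r k] rc True X \<epsilon>0 km by (intro mult_left_mono) auto
        ultimately show ?thesis unfolding sum d by (simp add: mult_ac)
      next
        case 3
        then have "?d k + ?d r = W' $$ (r, k) * V $$ (k, c) + W' $$ (r, c) - V $$ (r, c)"
          using rc True km keep[of k c] by (simp add: stored_L_def stored_U_def)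
        then show ?thesis unfolding sum d using upd(2)[of r c] rc True 3 by simp
      qed
    qed
  qed
  then show "entries_le m (?L' * ?U' -
      swaprows_mat m k p * (stored_L m k W * stored_U m k W)) (7 * X * \<epsilon>)"
    unfolding stored_swap[OF W kp] V_def .
qed

section \<open>The accumulated row permutation and the initial factorization\<close>

lemma interchanges_carrier: "interchanges m piv k \<in> carrier_mat m m"
  by (induction k) (auto intro: mult_carrier_mat)

lemma entries_le_interchanges:
  assumes "\<And>j. j < k \<Longrightarrow> j < m \<and> piv j < m"
  shows "entries_le m (interchanges m piv k) 1"
  using assms
proof (induction k)
  case 0
  show ?case by (simp add: entries_le_one)
next
  case (Suc k)
  then show ?case by (auto intro!: entries_le_swaprows_mult)
qed

text \<open>Multiplying the swaps on the right in reverse order only permutes columns, so a left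
  inverse with entries at most 1 exists for every pivot sequence. A bound depending on the pivots
  would depend on \<epsilon>.\<close>

lemma interchanges_left_inverse:
  assumes "\<And>j. j < k \<Longrightarrow> j < m \<and> piv j < m"
  shows "\<exists>Q. entries_le m Q 1 \<and> Q * interchanges m piv k = 1\<^sub>m m"
  using assms
proof (induction k)
  case 0
  show ?case using entries_le_one by (intro exI[of _ "1\<^sub>m m"]) simp
next
  case (Suc k)
  then obtain Q where Q: "entries_le m Q 1" "Q * interchanges m piv k = 1\<^sub>m m" by auto
  let ?S = "swaprows_mat m k (piv k)" and ?P = "interchanges m piv k"
  have k: "k < m" "piv k < m" using Suc.prems by auto
  note Qc = entries_le_carrier[OF Q(1)]
  have S: "?S \<in> carrier_mat m m" by simp
  note P = interchanges_carrier[of m piv k]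
  have "entries_le m (Q * ?S) 1"
    using Q(1) k swapcols_mat[OF Qc k, symmetric] by (auto simp: entries_le_def)
  moreover have "Q * ?S * (?S * ?P) = 1\<^sub>m m"
  proof -
    have "Q * ?S * (?S * ?P) = Q * (?S * (?S * ?P))"
      by (rule assoc_mult_mat[OF Qc S mult_carrier_mat[OF S P]])
    also have "?S * (?S * ?P) = ?S * ?S * ?P" by (rule assoc_mult_mat[OF S S P, symmetric])
    also have "\<dots> = ?P" using swaprows_mat_inv[OF k, where 'a = real] P by simp
    finally show ?thesis using Q(2) by simp
  qed
  ultimately show ?case by auto
qed

lemma gepp_bounds:
  assumes gepp: "gepp \<epsilon> m B P L U" and \<epsilon>: "0 \<le> \<epsilon>" "\<epsilon> \<le> 1" and B: "entries_le m B X" and m: "0 < m"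
  shows "entries_le m L 2" "entries_le m U (10 ^ m * X)"
    and "entries_le m (L * U - P * B) (real m * 10 ^ m * X * \<epsilon>)"
proof -
  from gepp obtain W piv where W0: "W 0 = B"
    and step: "\<And>k. k < m - 1 \<Longrightarrow> gepp_step \<epsilon> m k (piv k) (W k) (W (Suc k))"
    and P: "P = interchanges m piv (m - 1)"
    and L: "L = mat m m (\<lambda>(r, c). if c < r then W (m - 1) $$ (r, c) else if c = r then 1 else 0)"
    and U: "U = mat m m (\<lambda>(r, c). if r \<le> c then W (m - 1) $$ (r, c) else 0)"
    unfolding gepp_def by blast
  have Bc: "B \<in> carrier_mat m m" using B by (rule entries_le_carrier)
  let ?L = "\<lambda>k. stored_L m k (W k)" and ?U = "\<lambda>k. stored_U m k (W k)"
  have inv: "W k \<in> carrier_mat m m \<and> entries_le m (?L k) 2 \<and> entries_le m (?U k) (10 ^ k * X) \<and>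
    entries_le m (?L k * ?U k - interchanges m piv k * B) (real k * 10 ^ k * X * \<epsilon>)"
    if "k \<le> m - 1" for k
    using that
  proof (induction k)
    case 0
    have "?L 0 = 1\<^sub>m m" by (auto simp: stored_L_def)
    moreover have "?U 0 = B" using Bc by (auto simp: stored_U_def W0)
    ultimately show ?case
      using Bc B entries_le_mono[OF entries_le_one, of 2 m] by (auto simp: W0 entries_le_def)
  next
    case (Suc k)
    let ?S = "swaprows_mat m k (piv k)" and ?P = "interchanges m piv k"
    have k: "k < m - 1" and km: "k < m" using Suc.prems by auto
    have IH: "W k \<in> carrier_mat m m" "entries_le m (?L k) 2" "entries_le m (?U k) (10 ^ k * X)"
      "entries_le m (?L k * ?U k - ?P * B) (real k * 10 ^ k * X * \<epsilon>)"
      using Suc by auto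
    have pk: "piv k < m" and W': "W (Suc k) \<in> carrier_mat m m"
      using step[OF k] by (auto simp: gepp_step_def)
    note b = gepp_step_bounds[OF step[OF k] IH(1) \<epsilon> IH(2,3)]
    have X: "0 \<le> 10 ^ k * X" using entries_le_nonneg[OF IH(3)] km by simp
    have c: "?S \<in> carrier_mat m m" "?L k * ?U k \<in> carrier_mat m m" "?P * B \<in> carrier_mat m m"
      "?P \<in> carrier_mat m m" "?L (Suc k) * ?U (Suc k) \<in> carrier_mat m m"
      using stored_carrier interchanges_carrier Bc by (auto intro!: mult_carrier_mat[of _ m m])
    have eq: "?L (Suc k) * ?U (Suc k) - interchanges m piv (Suc k) * B =
      (?L (Suc k) * ?U (Suc k) - ?S * (?L k * ?U k)) + ?S * (?L k * ?U k - ?P * B)"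
    proof -
      have 1: "interchanges m piv (Suc k) * B = ?S * (?P * B)"
        unfolding interchanges.simps by (rule assoc_mult_mat[OF c(1,4) Bc])
      have 2: "?S * (?L k * ?U k - ?P * B) = ?S * (?L k * ?U k) - ?S * (?P * B)"
        by (rule mult_minus_distrib_mat[OF c(1-3)])
      show ?thesis unfolding 1 2
        by (rule mat_minus_triangle[OF c(5) mult_carrier_mat[OF c(1,2)] mult_carrier_mat[OF c(1,3)]])
    qed
    \<comment> \<open>The factor \<open>3 + 9 * real k\<close> is what remains of
      \<open>10 * (k + 1)\<close> after subtracting 7 for the new step and \<open>k\<close> for the
      inherited error.\<close>
    have "0 \<le> (10 ^ k * X) * \<epsilon> * (3 + 9 * real k)" using X \<epsilon> by simp
    then have le: "7 * (10 ^ k * X) * \<epsilon> + real k * 10 ^ k * X * \<epsilon> \<le> real (Suc k) * 10 ^ Suc k * X * \<epsilon>"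
      by (simp add: algebra_simps)
    have "entries_le m (?L (Suc k) * ?U (Suc k) - interchanges m piv (Suc k) * B)
      (real (Suc k) * 10 ^ Suc k * X * \<epsilon>)"
      unfolding eq
      by (rule entries_le_mono[OF entries_le_add[OF b(3) entries_le_swaprows_mult[OF km pk IH(4)]] le])
    then show ?case using W' b(1,2) by (simp add: mult_ac)
  qed
  \<comment> \<open>The last column has nothing below the diagonal, so the state after
    \<open>m - 1\<close> steps already holds the complete factors.\<close>
  have L': "L = ?L (m - 1)" unfolding L by (intro eq_matI) (auto simp: stored_L_def)
  have U': "U = ?U (m - 1)" unfolding U by (intro eq_matI) (auto simp: stored_U_def)
  note i = inv[OF order_refl]
  have X: "0 \<le> X" by (rule entries_le_nonneg[OF B m])
  show "entries_le m L 2" using i unfolding L' by blast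
  show "entries_le m U (10 ^ m * X)"
    by (rule entries_le_mono[of m U "10 ^ (m - 1) * X"])
      (use i X in \<open>auto simp: U' intro!: mult_right_mono power_increasing\<close>)
  show "entries_le m (L * U - P * B) (real m * 10 ^ m * X * \<epsilon>)"
    by (rule entries_le_mono[of m _ "real (m - 1) * 10 ^ (m - 1) * X * \<epsilon>"])
      (use i X \<epsilon> in \<open>auto simp: L' U' P intro!: mult_right_mono mult_mono power_increasing\<close>)
qed


section \<open>Hessenberg elimination\<close>

text \<open>The shape after the subdiagonal entries of the columns \<open>c < j\<close> have been eliminated.\<close>

definition hessenberg_from :: "nat \<Rightarrow> nat \<Rightarrow> real mat \<Rightarrow> bool" where
  "hessenberg_from m j R \<longleftrightarrow> (\<forall>r<m. \<forall>c<m. c < j \<and> c < r \<or> Suc c < r \<longrightarrow> R $$ (r, c) = 0)"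

text \<open>The hypothesis on the shape makes rows \<open>j\<close> and \<open>j + 1\<close> vanish
  left of column \<open>j\<close>, before and after the swap. The algorithm leaves these entries
  alone, while the stored factor acts on whole rows; both agree there because the added multiple is
  zero.\<close>

lemma hessenberg_step_bounds:
  assumes step: "hessenberg_step \<epsilon> m j s g R R'" and j: "Suc j < m" and \<epsilon>: "0 \<le> \<epsilon>" "\<epsilon> \<le> 1"
    and R: "entries_le m R X" and shape: "hessenberg_from m j R"
  shows "entries_le m R' (10 * X)" "hessenberg_from m (Suc j) R'" "\<bar>g\<bar> \<le> 1"
    and "entries_le m (swap_mat m j s * Gamma_inv_mat m j g * R' - R) (7 * X * \<epsilon>)"
proof -
  define V where "V = swap_mat m j s * R"
  have Rc: "R \<in> carrier_mat m m" using R by (rule entries_le_carrier)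
  have st: "R' \<in> carrier_mat m m" "\<bar>V $$ (Suc j, j)\<bar> \<le> \<bar>V $$ (j, j)\<bar>"
      "fl \<epsilon> (V $$ (Suc j, j) / V $$ (j, j)) g" "\<bar>g\<bar> \<le> 1"
      "\<And>r c. r < m \<Longrightarrow> c < m \<Longrightarrow>
        if r = Suc j \<and> c = j then R' $$ (r, c) = 0
         else if r = Suc j \<and> j < c then
           \<exists>t. fl \<epsilon> (g * V $$ (j, c)) t \<and> fl \<epsilon> (V $$ (r, c) - t) (R' $$ (r, c))
         else R' $$ (r, c) = V $$ (r, c)"
    using step unfolding hessenberg_step_def Let_def V_def[symmetric] by blast+
  show g: "\<bar>g\<bar> \<le> 1" by fact
  have keep: "R' $$ (r, c) = V $$ (r, c)" if "r < m" "c < m" "r \<noteq> Suc j \<or> c < j" for r c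
    using st(5)[of r c] that by (auto split: if_splits)
  have elim: "R' $$ (Suc j, j) = 0" using st(5)[of "Suc j" j] j by simp
  have V: "entries_le m V X" unfolding V_def by (rule entries_le_swap_mult[OF j R])
  have X: "0 \<le> X" using entries_le_nonneg[OF R] j by simp
  have upd: "\<bar>R' $$ (Suc j, c)\<bar> \<le> 10 * X"
    "\<bar>g * V $$ (j, c) + R' $$ (Suc j, c) - V $$ (Suc j, c)\<bar> \<le> 7 * X * \<epsilon>"
    if c: "c < m" "j < c" for c
  proof -
    obtain t where "fl \<epsilon> (g * V $$ (j, c)) t" "fl \<epsilon> (V $$ (Suc j, c) - t) (R' $$ (Suc j, c))"
      using st(5)[of "Suc j" c] c j by auto
    from fl_multiply_subtract[OF this \<epsilon>(2) _ entries_leD[OF V] entries_leD[OF V]] g c j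
    show "\<bar>R' $$ (Suc j, c)\<bar> \<le> 10 * X"
      "\<bar>g * V $$ (j, c) + R' $$ (Suc j, c) - V $$ (Suc j, c)\<bar> \<le> 7 * X * \<epsilon>" by auto
  qed
  show "entries_le m R' (10 * X)"
  proof (rule entries_leI[OF st(1)])
    fix r c assume rc: "r < m" "c < m"
    consider "r = Suc j" "c = j" | "r = Suc j" "j < c" | "r \<noteq> Suc j \<or> c < j" by linarith
    then show "\<bar>R' $$ (r, c)\<bar> \<le> 10 * X"
    proof cases
      case 3
      then show ?thesis using keep[OF rc] entries_leD[OF V rc] X by simp
    qed (use elim upd rc X in auto)
  qed
  have Vi: "V $$ (r, c) = R $$ (if s then (if r = j then Suc j else if r = Suc j then j else r) else r, c)"
    if "r < m" "c < m" for r c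
    unfolding V_def by (rule swap_mat_index[OF j Rc that])
  have zero: "V $$ (r, c) = 0" if "r \<in> {j, Suc j}" "c < j" for r c
    using that j shape by (auto simp: Vi hessenberg_from_def)
  show "hessenberg_from m (Suc j) R'"
    unfolding hessenberg_from_def
  proof (intro allI impI)
    fix r c assume rc: "r < m" "c < m" "c < Suc j \<and> c < r \<or> Suc c < r"
    consider "r = Suc j" "c = j" | "r \<in> {j, Suc j}" "c < j" | "r \<noteq> j" "r \<noteq> Suc j"
      using rc(3) by force
    then show "R' $$ (r, c) = 0"
    proof cases
      case 3
      \<comment> \<open>For \<open>c = j\<close> the row satisfies \<open>r > j + 1\<close>, and the
        Hessenberg alternative \<open>Suc c < r\<close> applies.\<close>
      have "R $$ (r, c) = 0" using shape rc 3 unfolding hessenberg_from_def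
        by (metis Suc_lessI less_Suc_eq)
      then show ?thesis using keep[OF rc(1,2)] Vi[OF rc(1,2)] 3 by simp
    qed (use elim zero[of r c] keep[OF rc(1,2)] in auto)
  qed
  let ?S = "swap_mat m j s" and ?\<Gamma> = "Gamma_inv_mat m j g"
  note S = swap_mat_carrier[of m j s] and \<Gamma> = Gamma_inv_mat_carrier[of m j g]
  note Vc = entries_le_carrier[OF V]
  have D: "entries_le m (?\<Gamma> * R' - V) (7 * X * \<epsilon>)"
  proof (rule entries_leI)
    show "?\<Gamma> * R' - V \<in> carrier_mat m m" by (rule minus_carrier_mat[OF Vc])
    fix r c assume rc: "r < m" "c < m"
    have "?\<Gamma> * R' = addrow g (Suc j) j R'"
      unfolding Gamma_inv_mat_def using addrow_mat[OF st(1), of j g "Suc j"] j by simp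
    then have i: "(?\<Gamma> * R' - V) $$ (r, c) =
      (if r = Suc j then g * V $$ (j, c) + R' $$ (r, c) - V $$ (r, c) else 0)"
      using rc Vc st(1) j keep[of r c] keep[of j c] by auto
    have n: "0 \<le> 7 * X * \<epsilon>" using X \<epsilon> by simp
    consider "r \<noteq> Suc j" | "r = Suc j" "c < j" | "r = Suc j" "c = j" | "r = Suc j" "j < c" by linarith
    then show "\<bar>(?\<Gamma> * R' - V) $$ (r, c)\<bar> \<le> 7 * X * \<epsilon>"
    proof cases
      case 1
      then show ?thesis using i n by simp
    next
      case 2
      then show ?thesis using i n zero[of j c] keep[OF rc] by simp
    next
      case 3
      have "\<bar>g * V $$ (j, j) - V $$ (Suc j, j)\<bar> \<le> \<epsilon> * \<bar>V $$ (Suc j, j)\<bar>"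
        by (rule fl_quotient_times_divisor[OF st(3,2)])
      also have "\<dots> \<le> \<epsilon> * (7 * X)"
        using entries_leD[OF V, of "Suc j" j] j X \<epsilon> by (intro mult_left_mono) auto
      finally show ?thesis using i 3 elim by (simp add: mult_ac)
    next
      case 4
      then show ?thesis using i upd(2)[of c] rc by simp
    qed
  qed
  have "?S * V = R"
    using assoc_mult_mat[OF S S Rc] swap_mat_involution[OF j, of s] Rc by (simp add: V_def)
  then have "?S * ?\<Gamma> * R' - R = ?S * (?\<Gamma> * R' - V)"
    using assoc_mult_mat[OF S \<Gamma> st(1)] mult_minus_distrib_mat[OF S mult_carrier_mat[OF \<Gamma> st(1)] Vc]
    by simp
  then show "entries_le m (?S * ?\<Gamma> * R' - R) (7 * X * \<epsilon>)"
    using entries_le_swap_mult[OF j D] by simp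
qed

section \<open>Column exchange and a complete update\<close>

lemma exchange_col_carrier: "exchange_col m l M a \<in> carrier_mat m m"
  by (simp add: exchange_col_def)

lemma hessenberg_from_exchange_col:
  assumes "upper_triangular U" "U \<in> carrier_mat m m" "l < m"
  shows "hessenberg_from m l (exchange_col m l U a)"
  using assms by (auto simp: hessenberg_from_def exchange_col_def upper_triangular_def)

lemma entries_le_exchange_col:
  assumes "entries_le m M X" "vec_entries_le m a X"
  shows "entries_le m (exchange_col m l M a) X"
  using assms by (auto simp: entries_le_def vec_entries_le_def exchange_col_def)

text \<open>A matrix product acts column by column. The residual after an exchange therefore
  consists of old residual columns and the residual of the newly solved column.\<close>

lemma mult_exchange_col:
  assumes "N \<in> carrier_mat m m" "M \<in> carrier_mat m m" "a \<in> carrier_vec m"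
  shows "N * exchange_col m l M a = exchange_col m l (N * M) (N *\<^sub>v a)"
proof (rule eq_matI)
  fix r c assume "r < dim_row (exchange_col m l (N * M) (N *\<^sub>v a))"
    and "c < dim_col (exchange_col m l (N * M) (N *\<^sub>v a))"
  then have rc: "r < m" "c < m" by (auto simp: exchange_col_def)
  show "(N * exchange_col m l M a) $$ (r, c) = exchange_col m l (N * M) (N *\<^sub>v a) $$ (r, c)"
    unfolding index_mult_mat_sum[OF assms(1) exchange_col_carrier rc]
    using rc index_mult_mat_sum[OF assms(1,2) rc] index_mult_mat_sum[OF assms(1,2) rc(1), of "Suc c"]
      index_mult_mat_vec_sum[OF assms(1,3) rc(1)]
    by (simp add: exchange_col_def del: index_mult_mat index_mult_mat_vec)
qed (use assms in \<open>auto simp: exchange_col_def\<close>)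

lemma minus_exchange_col:
  assumes "N \<in> carrier_mat m m" "M \<in> carrier_mat m m" "a \<in> carrier_vec m" "b \<in> carrier_vec m"
  shows "exchange_col m l M a - exchange_col m l N b = exchange_col m l (M - N) (a - b)"
  using assms by (intro eq_matI) (auto simp: exchange_col_def)

text \<open>Entry bounds and shape propagate forward through the columns. Afterwards all
  intermediate matrices share the bound \<open>10 ^ m * X\<close>, so every step has the same error
  bound; these errors are then accumulated backward from \<open>U'\<close>.\<close>

lemma bg_update_bounds:
  assumes upd: "bg_update \<epsilon> m l a sw g U U'" and l: "l < m" and \<epsilon>: "0 \<le> \<epsilon>" "\<epsilon> \<le> 1"
    and H: "entries_le m (exchange_col m l U a) X" and U: "upper_triangular U" "U \<in> carrier_mat m m"
  shows "entries_le m U' (10 ^ m * X)" "upper_triangular U'" "\<And>j. j \<in> {l..<m - 1} \<Longrightarrow> \<bar>g j\<bar> \<le> 1"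
    and "entries_le m (factor_prod m (map (\<lambda>j. (j, sw j, g j)) [l..<m - 1]) * U' - exchange_col m l U a)
      (real m * real m ^ m * (7 * (10 ^ m * X) * \<epsilon>))"
proof -
  from upd obtain R where R0: "R l = exchange_col m l U a"
    and step: "\<And>j. j \<in> {l..<m - 1} \<Longrightarrow> hessenberg_step \<epsilon> m j (sw j) (g j) (R j) (R (Suc j))"
    and U': "U' = R (m - 1)"
    unfolding bg_update_def by blast
  have X: "0 \<le> X" using entries_le_nonneg[OF H] l by simp
  have "entries_le m (R (l + n)) (10 ^ n * X) \<and> hessenberg_from m (l + n) (R (l + n))"
    if "l + n \<le> m - 1" for n
    using that
  proof (induction n)
    case 0
    show ?case using H hessenberg_from_exchange_col[OF U l] by (simp add: R0)
  next
    case (Suc n)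
    then have "l + n \<in> {l..<m - 1}" "Suc (l + n) < m" by auto
    from hessenberg_step_bounds(1,2)[OF step[OF this(1)] this(2) \<epsilon>, of "10 ^ n * X"] Suc
    show ?case by (simp add: mult_ac)
  qed
  moreover have "(10 :: real) ^ n * X \<le> 10 ^ m * X" if "l + n \<le> m - 1" for n
    using that X by (intro mult_right_mono power_increasing) auto
  ultimately have Rn: "entries_le m (R (l + n)) (10 ^ m * X) \<and> hessenberg_from m (l + n) (R (l + n))"
    if "l + n \<le> m - 1" for n
    using that entries_le_mono by blast
  have Rb: "entries_le m (R j) (10 ^ m * X)" "hessenberg_from m j (R j)" if "l \<le> j" "j \<le> m - 1" for j
    using Rn[of "j - l"] that by simp_all
  have lm: "l \<le> m - 1" using l by simp
  show U'b: "entries_le m U' (10 ^ m * X)" unfolding U' by (rule Rb(1)[OF lm order_refl])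
  show "upper_triangular U'"
    using Rb(2)[OF lm order_refl] entries_le_carrier[OF U'b]
    by (auto simp: hessenberg_from_def upper_triangular_def U')
  note hs = hessenberg_step_bounds[OF step _ \<epsilon> Rb]
  show "\<bar>g j\<bar> \<le> 1" if "j \<in> {l..<m - 1}" for j
    using that hs(3)[of j] by auto
  let ?E = "7 * (10 ^ m * X) * \<epsilon>"
  let ?F = "\<lambda>j. factor_prod m (map (\<lambda>j. (j, sw j, g j)) [j..<m - 1])"
  have E: "0 \<le> ?E" using X \<epsilon> by simp
  \<comment> \<open>Induction on the number \<open>n\<close> of remaining columns: the leftmost
    factor is split off \<open>?F j\<close>, and it enlarges the error of the rest by
    \<open>m\<close>.\<close>
  have "entries_le m (?F j * U' - R j) (real n * real m ^ n * ?E)" if "l \<le> j" "j + n = m - 1" for j n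
    using that
  proof (induction n arbitrary: j)
    case 0
    then have "j = m - 1" by simp
    then show ?case using entries_le_carrier[OF U'b] by (auto simp: U' entries_le_def)
  next
    case (Suc n)
    let ?M = "swap_mat m j (sw j) * Gamma_inv_mat m j (g j)"
    have j: "j \<in> {l..<m - 1}" "Suc j < m" "l \<le> j" "j \<le> m - 1" using Suc.prems by auto
    have IH: "entries_le m (?F (Suc j) * U' - R (Suc j)) (real n * real m ^ n * ?E)"
      using Suc by simp
    have d: "entries_le m (?M * R (Suc j) - R j) ?E" by (rule hs(4)[OF j(1,2,3,4) j(3,4)])
    have M: "entries_le m ?M 1"
      by (rule entries_le_swap_mult[OF j(2) entries_le_Gamma_inv[OF hs(3)[OF j(1,2,3,4) j(3,4)]]])
    have c: "?M \<in> carrier_mat m m" "?F (Suc j) \<in> carrier_mat m m" "U' \<in> carrier_mat m m"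
      "?F (Suc j) * U' \<in> carrier_mat m m" "R (Suc j) \<in> carrier_mat m m" "R j \<in> carrier_mat m m"
      using swap_Gamma_inv_carrier factor_prod_carrier entries_le_carrier[OF U'b] Rb(1)[of j] Rb(1)[of "Suc j"] j
      by (auto intro!: entries_le_carrier mult_carrier_mat[OF factor_prod_carrier])
    have "?F j = ?M * ?F (Suc j)" using j by (simp add: upt_conv_Cons)
    then have 1: "?F j * U' = ?M * (?F (Suc j) * U')" using assoc_mult_mat[OF c(1-3)] by simp
    have "?F j * U' - R j = (?F j * U' - ?M * R (Suc j)) + (?M * R (Suc j) - R j)"
      by (rule mat_minus_triangle[OF _ mult_carrier_mat[OF c(1,5)] c(6)])
        (rule mult_carrier_mat[OF factor_prod_carrier c(3)])
    also have "?F j * U' - ?M * R (Suc j) = ?M * (?F (Suc j) * U' - R (Suc j))"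
      unfolding 1 by (rule mult_minus_distrib_mat[OF c(1,4,5), symmetric])
    finally have eq: "?F j * U' - R j = ?M * (?F (Suc j) * U' - R (Suc j)) + (?M * R (Suc j) - R j)" .
    have "(1 :: real) \<le> real m ^ Suc n" using j by (intro one_le_power) simp
    then have "?E \<le> real m ^ Suc n * ?E" using E mult_right_mono[of 1 "real m ^ Suc n" ?E] by simp
    then have le: "real m * 1 * (real n * real m ^ n * ?E) + ?E \<le> real (Suc n) * real m ^ Suc n * ?E"
      by (simp add: algebra_simps)
    show ?case unfolding eq
      by (rule entries_le_mono[OF entries_le_add[OF entries_le_mult[OF M IH] d] le])
  qed
  from this[of l "m - 1 - l"] lm
  have "entries_le m (?F l * U' - R l) (real (m - 1 - l) * real m ^ (m - 1 - l) * ?E)" by simp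
  moreover have "real (m - 1 - l) * real m ^ (m - 1 - l) * ?E \<le> real m * real m ^ m * ?E"
    using E l by (intro mult_right_mono mult_mono power_increasing) auto
  ultimately show "entries_le m (?F l * U' - exchange_col m l U a) (real m * real m ^ m * ?E)"
    unfolding R0[symmetric] by (rule entries_le_mono)
qed


section \<open>The computed factorization\<close>

lemma gepp_shape:
  assumes "gepp \<epsilon> m B P L U" "0 < m"
  shows "entries_le m P 1" "\<exists>Q. entries_le m Q 1 \<and> Q * P = 1\<^sub>m m"
    and "upper_triangular U" "U \<in> carrier_mat m m"
    and "L \<in> carrier_mat m m" "\<And>r. r < m \<Longrightarrow> L $$ (r, r) = 1"
    and "\<And>r c. r < c \<Longrightarrow> c < m \<Longrightarrow> L $$ (r, c) = 0"
proof -
  from assms(1) obtain W piv where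
    step: "\<And>k. k < m - 1 \<Longrightarrow> gepp_step \<epsilon> m k (piv k) (W k) (W (Suc k))"
    and P: "P = interchanges m piv (m - 1)"
    and L: "L = mat m m (\<lambda>(r, c). if c < r then W (m - 1) $$ (r, c) else if c = r then 1 else 0)"
    and U: "U = mat m m (\<lambda>(r, c). if r \<le> c then W (m - 1) $$ (r, c) else 0)"
    unfolding gepp_def by blast
  have piv: "j < m \<and> piv j < m" if "j < m - 1" for j
    using step[OF that] that by (auto simp: gepp_step_def)
  show "entries_le m P 1" unfolding P using piv by (rule entries_le_interchanges)
  show "\<exists>Q. entries_le m Q 1 \<and> Q * P = 1\<^sub>m m" unfolding P using piv by (rule interchanges_left_inverse)
  show "upper_triangular U" "U \<in> carrier_mat m m" by (auto simp: U upper_triangular_def)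
  show "L \<in> carrier_mat m m" "\<And>r. r < m \<Longrightarrow> L $$ (r, r) = 1"
    "\<And>r c. r < c \<Longrightarrow> c < m \<Longrightarrow> L $$ (r, c) = 0" by (auto simp: L)
qed

text \<open>The number of stored factors is determined by the positions \<open>l\<close> alone, so
  bounds in terms of it are uniform over all interchanges and multipliers.\<close>

definition factor_count :: "nat \<Rightarrow> (nat \<Rightarrow> nat) \<Rightarrow> nat \<Rightarrow> nat" where
  "factor_count m l k = (\<Sum>k'\<leftarrow>[1..<Suc k]. m - 1 - l k')"

lemma length_factors_of_G: "length (factors_of_G m l sw g k) = factor_count m l k"
  by (simp add: factors_of_G_def factor_count_def length_concat comp_def del: upt_Suc)

lemma entries_le_G_mat:
  assumes "valid_factors m (factors_of_G m l sw g k)"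
  shows "entries_le m (G_mat m l sw g k) (real m ^ factor_count m l k)"
  using entries_le_factor_prod[OF assms] by (simp only: G_mat_eq_factor_prod length_factors_of_G)

lemma G_solve_error_le:
  assumes "G_solve \<epsilon> m l sw g k y z \<Delta>G" "valid_factors m (factors_of_G m l sw g k)" "0 \<le> \<epsilon>" "\<epsilon> \<le> 1"
  shows "entries_le m \<Delta>G (real (factor_count m l k) * real (2 * m) ^ factor_count m l k * \<epsilon>)"
  using assms(1) apply_factors_error_le[OF _ assms(2-4)]
  unfolding G_solve_def G_mat_eq_factor_prod length_factors_of_G by blast

lemma G_solve_solution_le:
  assumes "G_solve \<epsilon> m l sw g k y z \<Delta>G" "valid_factors m (factors_of_G m l sw g k)"
    "vec_entries_le m y X" "\<epsilon> \<le> 1"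
  shows "vec_entries_le m z (10 ^ factor_count m l k * X)"
  using assms(1) apply_factors_solution_le[OF _ assms(2-4)]
  unfolding G_solve_def length_factors_of_G by blast

text \<open>The two perturbed systems give
  \<open>b - L * G * a = \<Delta>L * y + L * \<Delta>G * a\<close>. With \<open>y\<close> and
  \<open>a\<close> bounded uniformly, both summands are of order \<epsilon>; the constant
  \<open>D\<close> of the proof collects their coefficients. The constant is obtained before
  \<epsilon> and all computed quantities, as the induction over the updates requires.\<close>

lemma column_solve_bounds:
  fixes m k :: nat and l :: "nat \<Rightarrow> nat" and X :: real
  assumes X: "0 \<le> X"
  obtains K where "0 \<le> K"
    and "\<And>\<epsilon> L sw g b y a \<Delta>L \<Delta>G. 0 \<le> \<epsilon> \<Longrightarrow> \<epsilon> < 1 \<Longrightarrow> entries_le m L 2 \<Longrightarrow>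
      \<forall>r<m. L $$ (r, r) = 1 \<Longrightarrow> \<forall>r c. r < c \<and> c < m \<longrightarrow> L $$ (r, c) = 0 \<Longrightarrow>
      vec_entries_le m b X \<Longrightarrow> valid_factors m (factors_of_G m l sw g k) \<Longrightarrow>
      forward_subst \<epsilon> m L b y \<Delta>L \<Longrightarrow> G_solve \<epsilon> m l sw g k y a \<Delta>G \<Longrightarrow>
      vec_entries_le m a K \<and> vec_entries_le m ((L * G_mat m l sw g k) *\<^sub>v a - b) (K * \<epsilon>)"
proof -
  define N where "N = factor_count m l k"
  define Y where "Y = (10 ^ m) ^ m * X"
  define Z where "Z = 10 ^ N * Y"
  define D where "D = real m * (2 ^ Suc m * 2) * Y + real m * 2 * (real m * (real N * real (2 * m) ^ N) * Z)"
  have pos: "0 \<le> Y" "0 \<le> Z" "0 \<le> D" using X by (auto simp: Y_def Z_def D_def)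
  show ?thesis
  proof (rule that[of "Z + D"]; (intro conjI)?)
    show "0 \<le> Z + D" using pos by simp
  next
    fix \<epsilon> L sw g b y a \<Delta>L \<Delta>G
    assume \<epsilon>: "0 \<le> \<epsilon>" "\<epsilon> < 1" and L: "entries_le m L 2" "\<forall>r<m. L $$ (r, r) = 1"
      "\<forall>r c. r < c \<and> c < m \<longrightarrow> L $$ (r, c) = 0" and b: "vec_entries_le m b X"
      and v: "valid_factors m (factors_of_G m l sw g k)"
      and fs: "forward_subst \<epsilon> m L b y \<Delta>L" and gs: "G_solve \<epsilon> m l sw g k y a \<Delta>G"
    have \<epsilon>': "\<epsilon> \<le> 1" using \<epsilon> by simp
    have y: "vec_entries_le m y Y" unfolding Y_def by (rule forward_subst_solution_le[OF fs \<epsilon>' L(1) b])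
    have a: "vec_entries_le m a Z" unfolding Z_def N_def by (rule G_solve_solution_le[OF gs v y \<epsilon>'])
    show "vec_entries_le m a (Z + D)" using a by (rule vec_entries_le_mono) (use pos in simp)
    have dL: "entries_le m \<Delta>L (2 ^ Suc m * 2 * \<epsilon>)" by (rule forward_subst_error_le[OF fs \<epsilon>(1) \<epsilon>' L(1)])
    have dG: "entries_le m \<Delta>G (real N * real (2 * m) ^ N * \<epsilon>)"
      unfolding N_def by (rule G_solve_error_le[OF gs v \<epsilon>(1) \<epsilon>'])
    let ?G = "G_mat m l sw g k"
    note c = entries_le_carrier[OF L(1)] entries_le_carrier[OF dL] G_mat_carrier[of m l sw g k]
      entries_le_carrier[OF dG] vec_entries_le_carrier[OF a] vec_entries_le_carrier[OF y]
      vec_entries_le_carrier[OF b]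
    have 1: "L *\<^sub>v y + \<Delta>L *\<^sub>v y = b"
      using forward_subst_backward_error[OF fs \<epsilon>(2) c(1)] L(2,3) c(7) add_mult_distrib_mat_vec[OF c(1,2,6)]
      by simp
    have 2: "?G *\<^sub>v a + \<Delta>G *\<^sub>v a = y"
      using G_solve_backward_error[OF gs \<epsilon>(2) c(6)] add_mult_distrib_mat_vec[OF c(3,4,5)] by simp
    have Ga: "?G *\<^sub>v a \<in> carrier_vec m" "\<Delta>G *\<^sub>v a \<in> carrier_vec m" using c by auto
    have 3: "L *\<^sub>v y = L *\<^sub>v (?G *\<^sub>v a) + L *\<^sub>v (\<Delta>G *\<^sub>v a)"
      unfolding 2[symmetric] by (rule mult_add_distrib_mat_vec[OF c(1) Ga])
    have LGa: "L *\<^sub>v (?G *\<^sub>v a) \<in> carrier_vec m" by (rule mult_mat_vec_carrier[OF c(1) Ga(1)])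
    have W: "\<Delta>L *\<^sub>v y \<in> carrier_vec m" "L *\<^sub>v (\<Delta>G *\<^sub>v a) \<in> carrier_vec m"
      using c Ga by auto
    have eq: "b - L *\<^sub>v (?G *\<^sub>v a) = \<Delta>L *\<^sub>v y + L *\<^sub>v (\<Delta>G *\<^sub>v a)"
    proof -
      have "p + q + r - p = r + q"
        if "p \<in> carrier_vec m" "q \<in> carrier_vec m" "r \<in> carrier_vec m" for p q r :: "real vec"
        using that by (intro eq_vecI) auto
      from this[OF LGa W(2,1)] show ?thesis unfolding 3[symmetric] 1 .
    qed
    have "vec_entries_le m (b - L *\<^sub>v (?G *\<^sub>v a))
      (real m * (2 ^ Suc m * 2 * \<epsilon>) * Y + real m * 2 * (real m * (real N * real (2 * m) ^ N * \<epsilon>) * Z))"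
      unfolding eq by (intro vec_entries_le_add vec_entries_le_mult dL dG y a L(1))
    moreover have "real m * (2 ^ Suc m * 2 * \<epsilon>) * Y + real m * 2 * (real m * (real N * real (2 * m) ^ N * \<epsilon>) * Z)
      = D * \<epsilon>" by (simp add: D_def algebra_simps)
    ultimately have "vec_entries_le m (L *\<^sub>v (?G *\<^sub>v a) - b) (D * \<epsilon>)"
      using vec_entries_le_minus_commute[OF _ c(7) LGa] by simp
    moreover have "D * \<epsilon> \<le> (Z + D) * \<epsilon>" using pos \<epsilon> by (intro mult_right_mono) auto
    ultimately show "vec_entries_le m ((L * ?G) *\<^sub>v a - b) ((Z + D) * \<epsilon>)"
      using assoc_mult_mat_vec[OF c(1,3,5)] by (simp add: vec_entries_le_mono)
  qed
qed

section \<open>The residual of the factorization through all updates\<close>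

lemma basis_mat_carrier: "basis_mat m A cs l e k \<in> carrier_mat m m"
  by (cases k) (auto simp: exchange_col_def)

lemma factors_of_G_Suc: "factors_of_G m l sw g (Suc k) =
    factors_of_G m l sw g k @ map (\<lambda>j. (j, sw (Suc k) j, g (Suc k) j)) [l (Suc k)..<m - 1]"
  by (simp add: factors_of_G_def)

text \<open>With \<open>H\<close> the matrix before the elimination, the new residual is
  \<open>L * G * (C * U' - H) + (L * G * H - P * B')\<close>. The first summand is the elimination
  error, enlarged by the bounded product \<open>L * G\<close>; the second is the old residual after
  an exchange of columns, with the residual of the solve as last column. The other conjuncts supply
  what the next update needs.\<close>

lemma bartels_golub_bounds:
  fixes A :: "real mat" and m n k :: nat
  assumes m: "0 < m" and A: "A \<in> carrier_mat m n" and le: "\<forall>k'\<in>{1..k}. l k' < m \<and> e k' < n"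
  shows "\<exists>K\<ge>0. \<forall>\<epsilon> P L sw g U. 0 \<le> \<epsilon> \<and> \<epsilon> < 1 \<and> bartels_golub \<epsilon> m A cs l e k P L sw g U \<longrightarrow>
    upper_triangular (U k) \<and> entries_le m (U k) K \<and> valid_factors m (factors_of_G m l sw g k) \<and>
    entries_le m L 2 \<and>
    entries_le m (L * G_mat m l sw g k * U k - P * basis_mat m A cs l e k) (K * \<epsilon>)"
  using le
proof (induction k)
  case 0
  let ?B = "basis_mat m A cs l e 0"
  obtain X where X: "1 \<le> X" "entries_le m ?B X"
    using entries_le_exists[OF basis_mat_carrier] by blast
  show ?case
  proof (intro exI[of _ "real m * 10 ^ m * X"] conjI allI impI; (elim conjE)?)
    show "0 \<le> real m * 10 ^ m * X" using X by simp
    fix \<epsilon> P L sw g U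
    assume \<epsilon>: "0 \<le> \<epsilon>" "\<epsilon> < 1" and "bartels_golub \<epsilon> m A cs l e 0 P L sw g U"
    then have g: "gepp \<epsilon> m ?B P L (U 0)" by (simp add: bartels_golub_def)
    note b = gepp_bounds[OF g \<epsilon>(1) less_imp_le[OF \<epsilon>(2)] X(2) m]
    show "upper_triangular (U 0)" by (rule gepp_shape(3)[OF g m])
    show "entries_le m L 2" by (rule b(1))
    have "1 * (10 ^ m * X) \<le> real m * (10 ^ m * X)" using m X by (intro mult_right_mono) auto
    then show "entries_le m (U 0) (real m * 10 ^ m * X)"
      using entries_le_mono[OF b(2)] by (simp add: mult_ac)
    show "valid_factors m (factors_of_G m l sw g 0)" by (simp add: valid_factors_def factors_of_G_def)
    show "entries_le m (L * G_mat m l sw g 0 * U 0 - P * ?B) (real m * 10 ^ m * X * \<epsilon>)"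
      using b(3) right_mult_one_mat[OF entries_le_carrier[OF b(1)]] by simp
  qed
next
  case (Suc k)
  let ?B = "basis_mat m A cs l e" and ?a = "col A (e (Suc k))" and ?l = "l (Suc k)"
  obtain K where K: "0 \<le> K" and IH: "\<And>\<epsilon> P L sw g U. 0 \<le> \<epsilon> \<Longrightarrow> \<epsilon> < 1 \<Longrightarrow>
      bartels_golub \<epsilon> m A cs l e k P L sw g U \<Longrightarrow>
    upper_triangular (U k) \<and> entries_le m (U k) K \<and> valid_factors m (factors_of_G m l sw g k) \<and>
    entries_le m L 2 \<and>
    entries_le m (L * G_mat m l sw g k * U k - P * ?B k) (K * \<epsilon>)"
    using Suc by force
  have lk: "?l < m" using Suc.prems by auto
  have ac: "?a \<in> carrier_vec m" using A by auto
  obtain Y where Y: "1 \<le> Y" "vec_entries_le m ?a Y" using vec_entries_le_exists[OF ac] by blast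
  have "0 \<le> real m * 1 * Y" using Y by simp
  then obtain J where J: "0 \<le> J" and
    col: "\<And>\<epsilon> L sw g b y a \<Delta>L \<Delta>G. 0 \<le> \<epsilon> \<Longrightarrow> \<epsilon> < 1 \<Longrightarrow> entries_le m L 2 \<Longrightarrow>
      \<forall>r<m. L $$ (r, r) = 1 \<Longrightarrow> \<forall>r c. r < c \<and> c < m \<longrightarrow> L $$ (r, c) = 0 \<Longrightarrow>
      vec_entries_le m b (real m * 1 * Y) \<Longrightarrow> valid_factors m (factors_of_G m l sw g k) \<Longrightarrow>
      forward_subst \<epsilon> m L b y \<Delta>L \<Longrightarrow> G_solve \<epsilon> m l sw g k y a \<Delta>G \<Longrightarrow>
      vec_entries_le m a J \<and> vec_entries_le m ((L * G_mat m l sw g k) *\<^sub>v a - b) (J * \<epsilon>)"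
  proof (rule column_solve_bounds[of "real m * 1 * Y" m l k], goal_cases)
    case (1 J)
    then show ?case by (intro that[of J])
  qed
  \<comment> \<open>\<open>X\<close> bounds both \<open>H\<close> (old columns by \<open>K\<close>,
    the appended one by \<open>J\<close>) and, times \<epsilon>, its residual. In \<open>D\<close>
    the elimination error is multiplied by the bound for \<open>L * G\<close>.\<close>
  define X where "X = K + J"
  define N where "N = factor_count m l k"
  define D where "D = real m * (real m * 2 * real m ^ N) * (real m * real m ^ m * (7 * (10 ^ m * X))) + X"
  have pos: "0 \<le> X" "0 \<le> D" using K J by (auto simp: X_def D_def)
  show ?case
  proof (intro exI[of _ "10 ^ m * X + D"] conjI allI impI; (elim conjE)?)
    show "0 \<le> 10 ^ m * X + D" using pos by simp
    fix \<epsilon> P L sw g U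
    assume \<epsilon>: "0 \<le> \<epsilon>" "\<epsilon> < 1" and bg: "bartels_golub \<epsilon> m A cs l e (Suc k) P L sw g U"
    have \<epsilon>': "\<epsilon> \<le> 1" using \<epsilon> by simp
    from bg have "bartels_golub \<epsilon> m A cs l e k P L sw g U" by (simp add: bartels_golub_def)
    note ih = IH[OF \<epsilon> this]
    let ?G = "G_mat m l sw g k" and ?C = "C_mat m l sw g (Suc k)"
    from bg obtain y \<Delta>L a \<Delta>G where
      gepp: "gepp \<epsilon> m (?B 0) P L (U 0)" and
      fs: "forward_subst \<epsilon> m L (P *\<^sub>v ?a) y \<Delta>L" and
      gs: "G_solve \<epsilon> m l sw g k y a \<Delta>G" and
      upd: "bg_update \<epsilon> m ?l a (sw (Suc k)) (g (Suc k)) (U k) (U (Suc k))"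
      unfolding bartels_golub_def by blast
    note sh = gepp_shape[OF gepp m]
    have L2: "entries_le m L 2" using ih by blast
    have Pa: "vec_entries_le m (P *\<^sub>v ?a) (real m * 1 * Y)" by (rule vec_entries_le_mult[OF sh(1) Y(2)])
    have a: "vec_entries_le m a J" "vec_entries_le m ((L * ?G) *\<^sub>v a - P *\<^sub>v ?a) (J * \<epsilon>)"
      using col[OF \<epsilon> L2 _ _ Pa _ fs gs] sh(6,7) ih by auto
    have KX: "K \<le> X" "J \<le> X" using K J by (auto simp: X_def)
    have KXe: "K * \<epsilon> \<le> X * \<epsilon>" "J * \<epsilon> \<le> X * \<epsilon>" using KX \<epsilon> by (auto intro: mult_right_mono)
    let ?H = "exchange_col m ?l (U k) a"
    have Uk: "U k \<in> carrier_mat m m" using ih by (blast intro: entries_le_carrier)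
    have H: "entries_le m ?H X"
      using ih a(1) KX by (intro entries_le_exchange_col) (auto intro: entries_le_mono vec_entries_le_mono)
    have ut: "upper_triangular (U k)" using ih by blast
    note ub = bg_update_bounds[OF upd lk \<epsilon>(1) \<epsilon>' H ut Uk]
    show "upper_triangular (U (Suc k))" by (rule ub(2))
    show "entries_le m L 2" by (rule L2)
    show "entries_le m (U (Suc k)) (10 ^ m * X + D)"
      by (rule entries_le_mono[OF ub(1)]) (use pos in simp)
    show "valid_factors m (factors_of_G m l sw g (Suc k))"
      using ih ub(3) by (auto simp: factors_of_G_Suc valid_factors_def)
    note c = entries_le_carrier[OF L2] G_mat_carrier[of m l sw g k] C_mat_carrier[of m l sw g "Suc k"]
      entries_le_carrier[OF ub(1)] exchange_col_carrier[of m ?l "U k" a]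
    have LG: "L * ?G \<in> carrier_mat m m" by (rule mult_carrier_mat[OF c(1,2)])
    have Pc: "P \<in> carrier_mat m m" by (rule entries_le_carrier[OF sh(1)])
    have CU: "?C * U (Suc k) \<in> carrier_mat m m" by (rule mult_carrier_mat[OF c(3,4)])
    have d1: "entries_le m (?C * U (Suc k) - ?H) (real m * real m ^ m * (7 * (10 ^ m * X) * \<epsilon>))"
      using ub(4) by (simp only: C_mat_eq_factor_prod)
    have eq1: "L * G_mat m l sw g (Suc k) * U (Suc k) = L * ?G * (?C * U (Suc k))"
      using assoc_mult_mat[OF c(1-3)] assoc_mult_mat[OF LG c(3,4)] by simp
    have d2: "entries_le m (L * ?G * ?H - P * ?B (Suc k)) (X * \<epsilon>)"
    proof -
      have eq: "L * ?G * ?H - P * ?B (Suc k) =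
        exchange_col m ?l (L * ?G * U k - P * ?B k) ((L * ?G) *\<^sub>v a - P *\<^sub>v ?a)"
        unfolding basis_mat.simps mult_exchange_col[OF LG Uk vec_entries_le_carrier[OF a(1)]]
          mult_exchange_col[OF Pc basis_mat_carrier ac]
        by (rule minus_exchange_col[OF mult_carrier_mat[OF Pc basis_mat_carrier] mult_carrier_mat[OF LG Uk]
              mult_mat_vec_carrier[OF LG vec_entries_le_carrier[OF a(1)]] mult_mat_vec_carrier[OF Pc ac]])
      have "entries_le m (L * ?G * U k - P * ?B k) (X * \<epsilon>)" using ih KXe by (blast intro: entries_le_mono)
      then show ?thesis unfolding eq
        by (rule entries_le_exchange_col[OF _ vec_entries_le_mono[OF a(2) KXe(2)]])
    qed
    have "L * G_mat m l sw g (Suc k) * U (Suc k) - P * ?B (Suc k) =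
      L * ?G * (?C * U (Suc k) - ?H) + (L * ?G * ?H - P * ?B (Suc k))"
      unfolding eq1 mult_minus_distrib_mat[OF LG CU c(5)]
      by (rule mat_minus_triangle[OF mult_carrier_mat[OF LG CU] mult_carrier_mat[OF LG c(5)]
            mult_carrier_mat[OF Pc basis_mat_carrier]])
    moreover have "entries_le m (L * ?G * (?C * U (Suc k) - ?H) + (L * ?G * ?H - P * ?B (Suc k)))
      (real m * (real m * 2 * real m ^ N) * (real m * real m ^ m * (7 * (10 ^ m * X) * \<epsilon>)) + X * \<epsilon>)"
      using ih unfolding N_def
      by (intro entries_le_add entries_le_mult d1 d2 L2 entries_le_G_mat) blast
    moreover have "real m * (real m * 2 * real m ^ N) * (real m * real m ^ m * (7 * (10 ^ m * X) * \<epsilon>)) + X * \<epsilon>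
      = D * \<epsilon>" by (simp add: D_def algebra_simps)
    moreover have "D * \<epsilon> \<le> (10 ^ m * X + D) * \<epsilon>" using pos \<epsilon> by (intro mult_right_mono) auto
    ultimately show "entries_le m (L * G_mat m l sw g (Suc k) * U (Suc k) - P * ?B (Suc k))
      ((10 ^ m * X + D) * \<epsilon>)" by (metis entries_le_mono)
  qed
qed


section \<open>The backward error\<close>

text \<open>The eight summands come from multiplying out the three perturbed factors, the
  unperturbed product being absorbed in \<open>\<Delta>B\<close>. Composing the three exactly
  satisfied systems thus gives the perturbed system for \<open>B\<close>.\<close>

lemma backward_error_expand:
  assumes c: "B \<in> carrier_mat m m" "L \<in> carrier_mat m m" "G \<in> carrier_mat m m" "U \<in> carrier_mat m m"
    "\<Delta>L \<in> carrier_mat m m" "\<Delta>G \<in> carrier_mat m m" "\<Delta>U \<in> carrier_mat m m"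
  shows "B + backward_error B L G U \<Delta>L \<Delta>G \<Delta>U = (L + \<Delta>L) * ((G + \<Delta>G) * (U + \<Delta>U))"
proof -
  let ?p = "\<lambda>X Y Z. X * Y * Z :: real mat"
  have p: "?p X Y Z \<in> carrier_mat m m"
    if "X \<in> carrier_mat m m" "Y \<in> carrier_mat m m" "Z \<in> carrier_mat m m" for X Y Z :: "real mat"
    by (rule mult_carrier_mat[OF mult_carrier_mat[OF that(1,2)] that(3)])
  have a: "X + Y \<in> carrier_mat m m" if "Y \<in> carrier_mat m m" for X Y :: "real mat"
    using that by simp
  have 1: "(L + \<Delta>L) * (G + \<Delta>G) = (L * G + \<Delta>L * G) + (L * \<Delta>G + \<Delta>L * \<Delta>G)"
    using mult_add_distrib_mat[OF a[OF c(5)] c(3,6)] add_mult_distrib_mat[OF c(2,5,3)]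
      add_mult_distrib_mat[OF c(2,5,6)] by simp
  have 2: "((L * G + \<Delta>L * G) + (L * \<Delta>G + \<Delta>L * \<Delta>G)) * Z =
    (?p L G Z + ?p \<Delta>L G Z) + (?p L \<Delta>G Z + ?p \<Delta>L \<Delta>G Z)" if Z: "Z \<in> carrier_mat m m" for Z
  proof -
    have k: "L * G \<in> carrier_mat m m" "\<Delta>L * G \<in> carrier_mat m m" "L * \<Delta>G \<in> carrier_mat m m"
      "\<Delta>L * \<Delta>G \<in> carrier_mat m m"
      using c mult_carrier_mat by blast+
    show ?thesis
      using add_mult_distrib_mat[OF a[OF k(2)] a[OF k(4)] Z] add_mult_distrib_mat[OF k(1,2) Z]
        add_mult_distrib_mat[OF k(3,4) Z] by simp
  qed
  have "(L + \<Delta>L) * ((G + \<Delta>G) * (U + \<Delta>U)) = (L + \<Delta>L) * (G + \<Delta>G) * (U + \<Delta>U)"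
    by (rule assoc_mult_mat[symmetric, OF a[OF c(5)] a[OF c(6)] a[OF c(7)]])
  also have "\<dots> = (L + \<Delta>L) * (G + \<Delta>G) * U + (L + \<Delta>L) * (G + \<Delta>G) * \<Delta>U"
    by (rule mult_add_distrib_mat[OF mult_carrier_mat[OF a[OF c(5)] a[OF c(6)]] c(4,7)])
  finally have 3: "(L + \<Delta>L) * ((G + \<Delta>G) * (U + \<Delta>U)) =
    ((?p L G U + ?p \<Delta>L G U) + (?p L \<Delta>G U + ?p \<Delta>L \<Delta>G U)) +
    ((?p L G \<Delta>U + ?p \<Delta>L G \<Delta>U) + (?p L \<Delta>G \<Delta>U + ?p \<Delta>L \<Delta>G \<Delta>U))"
    unfolding 1 2[OF c(4)] 2[OF c(7)] .
  \<comment> \<open>For arbitrary matrices in place of the products, the regrouping is plain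
    entrywise arithmetic.\<close>
  have "B + (p1 - B + p2 + p3 + p4 + p5 + p6 + p7 + p8) =
    ((p1 + p4) + (p3 + p7)) + ((p2 + p6) + (p5 + p8))"
    if "p1 \<in> carrier_mat m m" "p2 \<in> carrier_mat m m" "p3 \<in> carrier_mat m m" "p4 \<in> carrier_mat m m"
      "p5 \<in> carrier_mat m m" "p6 \<in> carrier_mat m m" "p7 \<in> carrier_mat m m" "p8 \<in> carrier_mat m m"
    for p1 p2 p3 p4 p5 p6 p7 p8 :: "real mat"
    using that c(1) by (intro eq_matI) auto
  then show ?thesis
    unfolding 3 backward_error_def Let_def using c by (simp only: p)
qed

section \<open>Size of the backward error and nonsingularity of the computed
  \<open>U\<close>\<close>

lemma entries_le_triple:
  assumes "entries_le m A a" "entries_le m B b" "entries_le m C c" "a * b * c \<le> X"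
  shows "entries_le m (A * B * C) (real m * real m * X)"
  using entries_le_mult[OF entries_le_mult[OF assms(1,2)] assms(3)]
  by (rule entries_le_mono) (use mult_left_mono[OF assms(4), of "real m * real m"] in \<open>simp add: mult_ac\<close>)

text \<open>Each of the seven triple products contains an error matrix. One keeps its factor
  \<epsilon>, any others are bounded by \<open>M\<close> because \<epsilon> is at most 1.\<close>

lemma backward_error_le:
  assumes B: "entries_le m (L * G * U - B) (M * \<epsilon>)"
    and f: "entries_le m L M" "entries_le m G M" "entries_le m U M"
    and \<Delta>: "entries_le m \<Delta>L (M * \<epsilon>)" "entries_le m \<Delta>G (M * \<epsilon>)" "entries_le m \<Delta>U (M * \<epsilon>)"
    and \<epsilon>: "0 \<le> \<epsilon>" "\<epsilon> \<le> 1" and M: "0 \<le> M"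
  shows "entries_le m (backward_error B L G U \<Delta>L \<Delta>G \<Delta>U)
    ((M + 7 * (real m * real m * (M * M * M))) * \<epsilon>)"
proof -
  have le: "M * \<epsilon> \<le> M" using M \<epsilon> by (simp add: mult_left_le)
  note \<Delta>' = \<Delta>[THEN entries_le_mono, OF le]
  let ?T = "M * M * M * \<epsilon>"
  have T: "M * M * (M * \<epsilon>) \<le> ?T" "M * (M * \<epsilon>) * M \<le> ?T" "(M * \<epsilon>) * M * M \<le> ?T" by auto
  have "entries_le m (backward_error B L G U \<Delta>L \<Delta>G \<Delta>U)
    (M * \<epsilon> + real m * real m * ?T + real m * real m * ?T + real m * real m * ?T + real m * real m * ?T
      + real m * real m * ?T + real m * real m * ?T + real m * real m * ?T)"
    unfolding backward_error_def Let_def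
    by (intro entries_le_add B;
        rule entries_le_triple[OF f(1) f(2) \<Delta>(3) T(1)] entries_le_triple[OF f(1) \<Delta>(2) f(3) T(2)]
          entries_le_triple[OF \<Delta>(1) f(2) f(3) T(3)] entries_le_triple[OF f(1) \<Delta>'(2) \<Delta>(3) T(1)]
          entries_le_triple[OF \<Delta>'(1) f(2) \<Delta>(3) T(1)] entries_le_triple[OF \<Delta>'(1) \<Delta>(2) f(3) T(2)]
          entries_le_triple[OF \<Delta>'(1) \<Delta>'(2) \<Delta>(3) T(1)])
  then show ?thesis by (simp add: algebra_simps)
qed

text \<open>A contraction argument: if \<open>M\<close> annihilates \<open>v\<close>, then
  \<open>P * B\<close> maps \<open>v\<close> to the negative of
  \<open>(M - P * B) *\<^sub>v v\<close>, and applying \<open>B' * Q\<close> recovers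
  \<open>v\<close>. The largest entry of \<open>v\<close> is thus at most a multiple of itself with
  factor below 1.\<close>

lemma kernel_trivial_of_close:
  assumes m: "0 < m" and B: "B \<in> carrier_mat m m" and P: "P \<in> carrier_mat m m"
    and B': "entries_le m B' \<beta>" "B' * B = 1\<^sub>m m" and Q: "entries_le m Q 1" "Q * P = 1\<^sub>m m"
    and M: "M \<in> carrier_mat m m" "entries_le m (M - P * B) \<delta>"
    and small: "real m * \<beta> * (real m * (real m * \<delta>)) < 1"
    and v: "v \<in> carrier_vec m" "M *\<^sub>v v = 0\<^sub>v m"
  shows "v = 0\<^sub>v m"
proof -
  define x where "x = Max ((\<lambda>r. \<bar>v $ r\<bar>) ` {..<m})"
  have vx: "vec_entries_le m v x" using v(1) by (intro vec_entries_leI) (auto simp: x_def)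
  have "x \<in> (\<lambda>r. \<bar>v $ r\<bar>) ` {..<m}" unfolding x_def using m by (intro Max_in) auto
  then obtain s where s: "s < m" "x = \<bar>v $ s\<bar>" by auto
  note c = entries_le_carrier[OF B'(1)] entries_le_carrier[OF Q(1)]
  have PB: "P * B \<in> carrier_mat m m" by (rule mult_carrier_mat[OF P B])
  have Bv: "B *\<^sub>v v \<in> carrier_vec m" by (rule mult_mat_vec_carrier[OF B v(1)])
  have PBv: "P *\<^sub>v (B *\<^sub>v v) \<in> carrier_vec m" by (rule mult_mat_vec_carrier[OF P Bv])
  have "(M - P * B) *\<^sub>v v = 0\<^sub>v m - P *\<^sub>v (B *\<^sub>v v)"
    using minus_mult_distrib_mat_vec[OF M(1) PB v(1)] assoc_mult_mat_vec[OF P B v(1)] v(2) by simp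
  then have "vec_entries_le m (0\<^sub>v m - P *\<^sub>v (B *\<^sub>v v)) (real m * \<delta> * x)"
    using vec_entries_le_mult[OF M(2) vx] by simp
  then have "vec_entries_le m (P *\<^sub>v (B *\<^sub>v v)) (real m * \<delta> * x)"
    using PBv vec_entries_le_minus_commute[OF _ zero_carrier_vec PBv] by simp
  then have "vec_entries_le m (B' *\<^sub>v (Q *\<^sub>v (P *\<^sub>v (B *\<^sub>v v)))) (real m * \<beta> * (real m * 1 * (real m * \<delta> * x)))"
    by (rule vec_entries_le_mult[OF B'(1) vec_entries_le_mult[OF Q(1)]])
  moreover have "B' *\<^sub>v (Q *\<^sub>v (P *\<^sub>v (B *\<^sub>v v))) = v"
  proof -
    have "Q *\<^sub>v (P *\<^sub>v (B *\<^sub>v v)) = B *\<^sub>v v"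
      using assoc_mult_mat_vec[OF c(2) P Bv] Q(2) Bv by simp
    then show ?thesis using assoc_mult_mat_vec[OF c(1) B v(1)] B'(2) v(1) by simp
  qed
  ultimately have "x \<le> real m * \<beta> * (real m * (real m * \<delta>)) * x"
    using vec_entries_leD[of m v _ s] s by (simp add: mult_ac)
  then have "(1 - real m * \<beta> * (real m * (real m * \<delta>))) * x \<le> 0" by (simp add: algebra_simps)
  then have "x \<le> 0" using small by (simp add: mult_le_0_iff)
  then show ?thesis using vec_entries_leD[OF vx] v(1) by (intro eq_vecI) force+
qed

lemma upper_triangular_diag_nonzero:
  fixes U :: "real mat"
  assumes "upper_triangular U" "U \<in> carrier_mat m m"
    and "\<And>v. v \<in> carrier_vec m \<Longrightarrow> U *\<^sub>v v = 0\<^sub>v m \<Longrightarrow> v = 0\<^sub>v m" and r: "r < m"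
  shows "U $$ (r, r) \<noteq> 0"
proof -
  have "det U \<noteq> 0" using det_0_iff_vec_prod_zero[OF assms(2)] assms(3) by blast
  then have "0 \<notin> set (diag_mat U)"
    unfolding det_upper_triangular[OF assms(1,2)] by (simp add: prod_list_zero_iff)
  then show ?thesis using r assms(2) by (force simp: diag_mat_def)
qed

theorem mainTheorem1:
  fixes A :: "real mat" and b :: "real vec" and m n i :: nat
    and cs :: "nat list" and l e :: "nat \<Rightarrow> nat"
  assumes "0 < m"
    and "A \<in> carrier_mat m n" and "elements_mat A \<subseteq> \<rat>"
    and "b \<in> carrier_vec m" and "set\<^sub>v b \<subseteq> \<rat>"
    and "0 < i"
    and "length cs = m" and "distinct cs" and "set cs \<subseteq> {..<n}"
    and "\<forall>k\<in>{1..i}. l k < m \<and> e k < n"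
    and "\<forall>k\<le>i. invertible_mat (basis_mat m A cs l e k)"
  shows "\<exists>K>0. \<exists>\<epsilon>\<^sub>0>0. \<forall>\<epsilon>. 0 < \<epsilon> \<and> \<epsilon> < \<epsilon>\<^sub>0 \<longrightarrow>
    (\<forall>P L sw g U y z x \<Delta>L \<Delta>G \<Delta>U.
       bartels_golub \<epsilon> m A cs l e i P L sw g U \<and>
       forward_subst \<epsilon> m L (P *\<^sub>v b) y \<Delta>L \<and>
       G_solve \<epsilon> m l sw g i y z \<Delta>G \<and>
       backward_subst \<epsilon> m (U i) z x \<Delta>U \<longrightarrow>
       (let B = P * basis_mat m A cs l e i;
            E = backward_error B L (G_mat m l sw g i) (U i) \<Delta>L \<Delta>G \<Delta>U
        in (B + E) *\<^sub>v x = P *\<^sub>v b \<and> \<bar>norm1_mat E\<bar> \<le> K * \<bar>\<epsilon>\<bar>))"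
proof -
  note m = \<open>0 < m\<close>
  let ?B = "basis_mat m A cs l e i"
  note Bc = basis_mat_carrier[of m A cs l e i]
  obtain K where K: "0 \<le> K" and bounds: "\<And>\<epsilon> P L sw g U. 0 \<le> \<epsilon> \<Longrightarrow> \<epsilon> < 1 \<Longrightarrow>
      bartels_golub \<epsilon> m A cs l e i P L sw g U \<Longrightarrow>
    upper_triangular (U i) \<and> entries_le m (U i) K \<and> valid_factors m (factors_of_G m l sw g i) \<and>
    entries_le m L 2 \<and>
    entries_le m (L * G_mat m l sw g i * U i - P * ?B) (K * \<epsilon>)"
    using bartels_golub_bounds[OF m assms(2,10), of cs] by force
  \<comment> \<open>\<open>inverts_mat\<close> leaves the dimensions of the inverse open; comparing
    the columns of both products fixes them.\<close>
  obtain B' where B': "B' \<in> carrier_mat m m" "B' * ?B = 1\<^sub>m m"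
  proof -
    obtain C where C: "?B * C = 1\<^sub>m m" "C * ?B = 1\<^sub>m (dim_row C)"
      using assms(11) Bc by (auto simp: invertible_mat_def inverts_mat_def)
    have "dim_col C = m" using arg_cong[OF C(1), of dim_col] by simp
    moreover have "dim_row C = m" using arg_cong[OF C(2), of dim_col] Bc by simp
    ultimately show ?thesis using that[of C] C by auto
  qed
  obtain \<beta> where \<beta>: "1 \<le> \<beta>" "entries_le m B' \<beta>" using entries_le_exists[OF B'(1)] by blast
  define N where "N = factor_count m l i"
  define M where "M = 2 + real m ^ N + K + 2 ^ Suc m * 2 + real N * real (2 * m) ^ N + 2 ^ Suc m * K"
  \<comment> \<open>\<open>S * \<epsilon>\<close> is the contraction factor in
    \<open>kernel_trivial_of_close\<close>. The threshold \<open>1 / (1 + S)\<close> makes both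
    \<epsilon> and this factor smaller than 1.\<close>
  define S where "S = real m * \<beta> * (real m * (real m * K))"
  define E where "E = M + 7 * (real m * real m * (M * M * M))"
  have ge: "0 \<le> real m ^ N" "0 \<le> real N * real (2 * m) ^ N" "0 \<le> 2 ^ Suc m * K"
    "(0::real) \<le> 2 ^ Suc m * 2" using K by auto
  have M: "2 \<le> M" "real m ^ N \<le> M" "K \<le> M" "2 ^ Suc m * 2 \<le> M" "real N * real (2 * m) ^ N \<le> M"
    "2 ^ Suc m * K \<le> M"
    using ge K unfolding M_def by linarith+
  have S0: "0 \<le> S" using \<beta> K by (simp add: S_def)
  have E0: "0 < E" unfolding E_def using M(1) by (intro add_pos_nonneg) auto
  show ?thesis
  proof (rule exI[of _ "real m * E"], rule conjI[OF _ exI[of _ "1 / (1 + S)"]];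
      (intro conjI allI impI)?; (elim conjE)?)
    show "0 < real m * E" using E0 m by simp
    show "0 < 1 / (1 + S)" using S0 by simp
  next
    fix \<epsilon> P L sw g U y z x \<Delta>L \<Delta>G \<Delta>U
    assume \<epsilon>: "0 < \<epsilon>" "\<epsilon> < 1 / (1 + S)" and bg: "bartels_golub \<epsilon> m A cs l e i P L sw g U"
      and fs: "forward_subst \<epsilon> m L (P *\<^sub>v b) y \<Delta>L" and gs: "G_solve \<epsilon> m l sw g i y z \<Delta>G"
      and bs: "backward_subst \<epsilon> m (U i) z x \<Delta>U"
    have S1: "\<epsilon> + S * \<epsilon> < 1" using \<epsilon>(2) S0 by (simp add: field_simps)
    have "0 \<le> S * \<epsilon>" using S0 \<epsilon>(1) by simp
    then have \<epsilon>1: "\<epsilon> < 1" "0 \<le> \<epsilon>" "\<epsilon> \<le> 1" and Se: "S * \<epsilon> < 1" using S1 \<epsilon>(1) by linarith+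
    let ?G = "G_mat m l sw g i" and ?U = "U i"
    note bd = bounds[OF \<epsilon>1(2,1) bg]
    have ut: "upper_triangular ?U" and U: "entries_le m ?U K"
      and val: "valid_factors m (factors_of_G m l sw g i)" and L: "entries_le m L 2"
      and res: "entries_le m (L * ?G * ?U - P * ?B) (K * \<epsilon>)"
      using bd by auto
    have gepp: "gepp \<epsilon> m (basis_mat m A cs l e 0) P L (U 0)" using bg by (simp add: bartels_golub_def)
    note sh = gepp_shape[OF gepp m]
    obtain Q where Q: "entries_le m Q 1" "Q * P = 1\<^sub>m m" using sh(2) by blast
    have G: "entries_le m ?G (real m ^ N)" unfolding N_def by (rule entries_le_G_mat[OF val])
    have dL: "entries_le m \<Delta>L (2 ^ Suc m * 2 * \<epsilon>)" by (rule forward_subst_error_le[OF fs \<epsilon>1(2,3) L])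
    have dG: "entries_le m \<Delta>G (real N * real (2 * m) ^ N * \<epsilon>)"
      unfolding N_def by (rule G_solve_error_le[OF gs val \<epsilon>1(2,3)])
    have dU: "entries_le m \<Delta>U (2 ^ Suc m * K * \<epsilon>)" by (rule backward_subst_error_le[OF bs \<epsilon>1(2,3) U])
    note c = entries_le_carrier[OF L] entries_le_carrier[OF G] entries_le_carrier[OF U]
      entries_le_carrier[OF dL] entries_le_carrier[OF dG] entries_le_carrier[OF dU]
    have P: "P \<in> carrier_mat m m" by (rule entries_le_carrier[OF sh(1)])
    have LG: "L * ?G \<in> carrier_mat m m" by (rule mult_carrier_mat[OF c(1,2)])
    have Pb: "P *\<^sub>v b \<in> carrier_vec m" by (rule mult_mat_vec_carrier[OF P assms(4)])
    have y: "y \<in> carrier_vec m" using fs by (simp add: forward_subst_def)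
    have x: "x \<in> carrier_vec m" using bs by (simp add: backward_subst_def)
    have z: "z \<in> carrier_vec m"
      using vec_entries_le_exists[OF y] G_solve_solution_le[OF gs val _ \<epsilon>1(3)] vec_entries_le_carrier by blast
    \<comment> \<open>The kernel of \<open>U\<close> lies in that of \<open>L * G * U\<close>, which
      is close to the nonsingular \<open>P * B\<close>.\<close>
    have "v = 0\<^sub>v m" if v: "v \<in> carrier_vec m" "?U *\<^sub>v v = 0\<^sub>v m" for v
    proof (rule kernel_trivial_of_close[OF m Bc P \<beta>(2) B'(2) Q mult_carrier_mat[OF LG c(3)] res _ v(1)])
      show "real m * \<beta> * (real m * (real m * (K * \<epsilon>))) < 1" using Se by (simp add: S_def mult_ac)
      show "(L * ?G * ?U) *\<^sub>v v = 0\<^sub>v m"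
        unfolding assoc_mult_mat_vec[OF LG c(3) v(1)] v(2)
        using c(1) by (intro eq_vecI)
          (simp_all add: index_mult_mat_vec_sum[OF LG zero_carrier_vec] del: index_mult_mat_vec)
    qed
    then have diag: "?U $$ (r, r) \<noteq> 0" if "r < m" for r
      using upper_triangular_diag_nonzero[OF ut c(3) _ that] by blast
    have 1: "(L + \<Delta>L) *\<^sub>v y = P *\<^sub>v b"
      by (rule forward_subst_backward_error[OF fs \<epsilon>1(1) c(1) sh(6,7) Pb])
    have 2: "(?G + \<Delta>G) *\<^sub>v z = y" by (rule G_solve_backward_error[OF gs \<epsilon>1(1) y])
    have 3: "(?U + \<Delta>U) *\<^sub>v x = z"
      using ut c(3) by (intro backward_subst_backward_error[OF bs \<epsilon>1(1) c(3) diag _ z]) auto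
    have s: "L + \<Delta>L \<in> carrier_mat m m" "?G + \<Delta>G \<in> carrier_mat m m" "?U + \<Delta>U \<in> carrier_mat m m"
      using c by auto
    let ?E = "backward_error (P * ?B) L ?G ?U \<Delta>L \<Delta>G \<Delta>U"
    have "(P * ?B + ?E) *\<^sub>v x = P *\<^sub>v b"
      unfolding backward_error_expand[OF mult_carrier_mat[OF P Bc] c]
        assoc_mult_mat_vec[OF s(1) mult_carrier_mat[OF s(2,3)] x] assoc_mult_mat_vec[OF s(2,3) x] 3 2 1 ..
    moreover have "\<bar>norm1_mat ?E\<bar> \<le> real m * E * \<bar>\<epsilon>\<bar>"
    proof -
      have r: "a * \<epsilon> \<le> M * \<epsilon>" if "a \<le> M" for a using that \<epsilon>1(2) by (rule mult_right_mono)
      have "entries_le m ?E (E * \<epsilon>)"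
        unfolding E_def
        by (rule backward_error_le[OF entries_le_mono[OF res r[OF M(3)]]
              entries_le_mono[OF L M(1)] entries_le_mono[OF G M(2)] entries_le_mono[OF U M(3)]
              entries_le_mono[OF dL r[OF M(4)]] entries_le_mono[OF dG r[OF M(5)]]
              entries_le_mono[OF dU r[OF M(6)]] \<epsilon>1(2,3)]) (use M(1) in simp)
      from norm1_mat_le[OF this m] show ?thesis using \<epsilon>1(2) by (simp add: mult_ac)
    qed
    ultimately show "let B = P * ?B; E' = backward_error B L ?G ?U \<Delta>L \<Delta>G \<Delta>U
        in (B + E') *\<^sub>v x = P *\<^sub>v b \<and> \<bar>norm1_mat E'\<bar> \<le> real m * E * \<bar>\<epsilon>\<bar>"
      unfolding Let_def by blast
  qed
qed

end
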